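(* Let $k\ge 2$ be an integer and let $G$ be a graph of order $n\ge 2k+6$ without isolated vertices. If $q(G)\ge q(K_2\vee(2K_1\cup K_{n-4}))$, then for every edge $e$ of $G$ there is an $S(k)$-factor of $G$ in which the component containing $e$ is isomorphic to $K_{1,1}$ or $K_{1,2}$, unless $G\cong K_2\vee(2K_1\cup K_{n-4})$.
   Context: All graphs are finite, simple and undirected. A factor of $G$ is a spanning subgraph. $K_{1,m}$ is the star with $m+1$ vertices. For a positive integer $k$, an $S(k)$-factor of $G$ is a factor each of whose components is isomorphic to one of $K_{1,1},K_{1,2},\dots,K_{1,k}$. $q(G)$ is the largest eigenvalue of $\mathbf{D}(G)+\mathbf{A}(G)$ (degree diagonal matrix plus adjacency matrix). $K_m$ is the complete graph on $m$ vertices, $mH$ is the disjoint union of $m$ copies of $H$, $\cup$ is disjoint union, and $\vee$ is the join. *)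

theory Defs
  imports "Graph_Theory.Graph_Theory" "Jordan_Normal_Form.Spectral_Radius"
begin

text \<open>
  Finite simple undirected graphs are the symmetric, loop-free, finite digraphs \<open>pair_graph\<close> of the
  library: an undirected edge between \<open>u\<close> and \<open>v\<close> is the pair of arcs \<open>(u, v)\<close>, \<open>(v, u)\<close>.
  Consequently the degree of a vertex is its \<open>out_degree\<close>, the connected components are the \<open>sccs\<close>,
  and \<open>K\<^bsub>m,n\<^esub> H\<close> says that \<open>H\<close> is a (symmetric) complete bipartite graph with parts
  of size \<open>m\<close> and \<open>n\<close>, i.e. isomorphic to the usual \<open>K\<^bsub>m,n\<^esub>\<close>.
\<close>

definition complete_graph :: "nat \<Rightarrow> nat pair_pre_digraph" where
  "complete_graph n = \<lparr> pverts = {..<n}, parcs = {(u, v). u < n \<and> v < n \<and> u \<noteq> v} \<rparr>"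

definition disjoint_union ::
  "'a pair_pre_digraph \<Rightarrow> 'b pair_pre_digraph \<Rightarrow> ('a + 'b) pair_pre_digraph" where
  "disjoint_union G H =
    \<lparr> pverts = pverts G <+> pverts H,
      parcs = {(Inl u, Inl v) | u v. (u, v) \<in> parcs G} \<union> {(Inr u, Inr v) | u v. (u, v) \<in> parcs H} \<rparr>"

definition graph_join ::
  "'a pair_pre_digraph \<Rightarrow> 'b pair_pre_digraph \<Rightarrow> ('a + 'b) pair_pre_digraph" where
  "graph_join G H =
    \<lparr> pverts = pverts G <+> pverts H,
      parcs = parcs (disjoint_union G H)
        \<union> (Inl ` pverts G) \<times> (Inr ` pverts H) \<union> (Inr ` pverts H) \<times> (Inl ` pverts G) \<rparr>"

definition graph_copies :: "nat \<Rightarrow> 'a pair_pre_digraph \<Rightarrow> (nat \<times> 'a) pair_pre_digraph" where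
  "graph_copies m H =
    \<lparr> pverts = {..<m} \<times> pverts H,
      parcs = {((i, u), (i, v)) | i u v. i < m \<and> (u, v) \<in> parcs H} \<rparr>"

text \<open>\<open>K\<^sub>2 \<or> (2 K\<^sub>1 \<union> K\<^bsub>n-4\<^esub>)\<close>, where \<open>\<or>\<close> is the join; only meaningful for \<open>n \<ge> 4\<close>.\<close>

definition extremal_graph :: "nat \<Rightarrow> (nat + (nat \<times> nat) + nat) pair_pre_digraph" where
  "extremal_graph n =
    graph_join (complete_graph 2)
      (disjoint_union (graph_copies 2 (complete_graph 1)) (complete_graph (n - 4)))"

text \<open>Matrices of a graph with respect to an enumeration \<open>vs\<close> of its vertices.\<close>

definition degree_matrix :: "'a pair_pre_digraph \<Rightarrow> 'a list \<Rightarrow> real mat" where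
  "degree_matrix G vs = mat (length vs) (length vs)
    (\<lambda>(i, j). if i = j then real (out_degree (with_proj G) (vs ! i)) else 0)"

definition adjacency_matrix :: "'a pair_pre_digraph \<Rightarrow> 'a list \<Rightarrow> real mat" where
  "adjacency_matrix G vs = mat (length vs) (length vs)
    (\<lambda>(i, j). if (vs ! i, vs ! j) \<in> parcs G then 1 else 0)"

text \<open>
  Different enumerations give permutation-similar matrices, so the choice does not matter; as the
  matrix is real symmetric, its real spectrum is its whole spectrum.
\<close>

definition q_index :: "'a pair_pre_digraph \<Rightarrow> real" where
  "q_index G =
    (let vs = (SOME vs. distinct vs \<and> set vs = pverts G)
     in Max (spectrum (degree_matrix G vs + adjacency_matrix G vs)))"

definition factor :: "'a pair_pre_digraph \<Rightarrow> 'a pair_pre_digraph \<Rightarrow> bool" where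
  "factor F G \<longleftrightarrow> pair_graph F \<and> spanning (with_proj F) (with_proj G)"

abbreviation components :: "'a pair_pre_digraph \<Rightarrow> ('a, 'a \<times> 'a) pre_digraph set" where
  "components F \<equiv> pre_digraph.sccs (with_proj F)"

definition star_factor :: "nat \<Rightarrow> 'a pair_pre_digraph \<Rightarrow> 'a pair_pre_digraph \<Rightarrow> bool" where
  "star_factor k F G \<longleftrightarrow>
    factor F G \<and> (\<forall>C \<in> components F. \<exists>m. 1 \<le> m \<and> m \<le> k \<and> K\<^bsub>1,m\<^esub> C)"

end

theory Submission
  imports Defs
begin

text \<open>
  An \<open>S(2)\<close>-factor is an \<open>S(k)\<close>-factor, so only \<open>k = 2\<close> matters. A factor with components
  \<open>K\<^bsub>1,1\<^esub>\<close> and \<open>K\<^bsub>1,2\<^esub>\<close> through \<open>e = uv\<close> exists as soon as a Hall condition holds in which every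
  vertex other than \<open>u, v\<close> has capacity 2 while \<open>u\<close> and \<open>v\<close> together have capacity 1. A violating
  set can be shrunk to an independent set \<open>T\<close> with few neighbours \<open>S\<close>. If \<open>S = {u, v}\<close>, then \<open>G\<close> is a
  spanning subgraph of the extremal graph, and a proper one has strictly smaller \<open>q\<close>. In all
  other cases \<open>T\<close> is so large that a positive vector \<open>x\<close>, constant on \<open>S\<close>, \<open>T\<close> and the rest, satisfies
  \<open>Q x \<le> (2n - 6 + 4/n) x\<close>, whereas the extremal graph has \<open>q > 2n - 6 + 4/n\<close>.
\<close>

section \<open>Edge covers through a prescribed arc\<close>

text \<open>The component of \<open>uv\<close> may have at most three vertices, so besides
  \<open>u\<close> and \<open>v\<close> it can absorb only one more; hence their joint capacity 1.
  Hall's theorem alone gives no factor: it sends each vertex outside \<open>{u, v}\<close> to a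
  neighbour, at most two to the same one, but a vertex that receives two and is itself sent
  elsewhere has degree three. Some assignments must be dropped without uncovering a vertex. Pruning
  to a minimal edge cover then leaves stars, and \<open>uv\<close> survives because one of its ends
  has no other neighbour.

  The spectral margin is thin. The extremal graph exceeds 2n - 6 only by an amount of order 1/n, and
  for n = 10 the test vector for the other violators can give no better than 2n - 6 + 4/n, so
  strictness has to come from the extremal graph. Perron-Frobenius theory is avoided: an explicit
  positive eigenvector bounds the index from below, and any positive vector bounds it from above row
  by row.\<close>

lemma hall_marriage:
  fixes A :: "'i \<Rightarrow> 'b set"
  assumes "finite I" and "\<And>i. i \<in> I \<Longrightarrow> finite (A i)"
    and "\<And>J. J \<subseteq> I \<Longrightarrow> card J \<le> card (\<Union> (A ` J))"
  shows "\<exists>f. inj_on f I \<and> (\<forall>i\<in>I. f i \<in> A i)"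
  using assms
proof (induction "card I" arbitrary: I A rule: less_induct)
  case less
  note fin = less.prems(1,2) and hall = less.prems(3)
  show ?case
  proof (cases "I = {}")
    case False
    show ?thesis
    proof (cases "\<exists>J\<subset>I. J \<noteq> {} \<and> card (\<Union> (A ` J)) \<le> card J")
      \<comment> \<open>Every nonempty proper subset has a candidate to spare, so any
        \<open>a\<close> may be given to \<open>i\<close>: the remaining subsets lose at most that
        one candidate.\<close>
      case False
      obtain i where i: "i \<in> I" using \<open>I \<noteq> {}\<close> by blast
      have "card {i} \<le> card (\<Union> (A ` {i}))" using i by (intro hall) auto
      then have "A i \<noteq> {}" by auto
      then obtain a where a: "a \<in> A i" by blast
      have "card (I - {i}) < card I" using fin(1) i by (intro card_Diff1_less) auto
      then have "\<exists>f. inj_on f (I - {i}) \<and> (\<forall>j\<in>I - {i}. f j \<in> A j - {a})"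
      proof (rule less.hyps)
        fix J assume J: "J \<subseteq> I - {i}"
        show "card J \<le> card (\<Union>j\<in>J. A j - {a})"
        proof (cases "J = {}")
          case ne: False
          have "J \<subset> I" using J i by auto
          then have "card J < card (\<Union> (A ` J))" using ne False by (meson not_less)
          moreover have "(\<Union>j\<in>J. A j - {a}) = \<Union> (A ` J) - {a}" by auto
          moreover have "card (\<Union> (A ` J)) - 1 \<le> card (\<Union> (A ` J) - {a})"
            by (simp add: card_Diff_singleton_if)
          ultimately show ?thesis by simp
        qed simp
      qed (use fin in auto)
      then obtain f where f: "inj_on f (I - {i})" "\<forall>j\<in>I - {i}. f j \<in> A j - {a}" by blast
      have "inj_on (f(i := a)) I"
        using f unfolding inj_on_def by auto
      then show ?thesis
        using f a by (intro exI[of _ "f(i := a)"]) auto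
    next
      \<comment> \<open>A tight \<open>J\<close> uses up all its candidates, so the other indices
        must be matched outside \<open>?T\<close>. Hall's condition for \<open>K\<close> there is
        the one for \<open>K \<union> J\<close> minus the tight part.\<close>
      case True
      then obtain J where J: "J \<subset> I" "J \<noteq> {}" "card (\<Union> (A ` J)) \<le> card J" by blast
      let ?T = "\<Union> (A ` J)"
      have finJ: "finite J" using J(1) fin(1) by (auto intro: finite_subset)
      have finT: "finite ?T" using finJ J(1) fin(2) by (intro finite_UN_I) auto
      have "card J < card I" using J(1) fin(1) by (rule psubset_card_mono[rotated])
      then have "\<exists>f. inj_on f J \<and> (\<forall>j\<in>J. f j \<in> A j)"
      proof (rule less.hyps)
        fix K assume "K \<subseteq> J"
        then show "card K \<le> card (\<Union> (A ` K))" using J(1) by (intro hall) auto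
      qed (use finJ J(1) fin(2) in auto)
      then obtain f where f: "inj_on f J" "\<forall>j\<in>J. f j \<in> A j" by blast
      have "card (I - J) < card I" using J fin(1) by (intro psubset_card_mono) auto
      then have "\<exists>g. inj_on g (I - J) \<and> (\<forall>j\<in>I - J. g j \<in> A j - ?T)"
      proof (rule less.hyps)
        fix K assume K: "K \<subseteq> I - J"
        have "finite K" using K fin(1) by (auto intro: finite_subset)
        moreover from this have "finite (\<Union>j\<in>K. A j - ?T)"
          using K fin(2) by (intro finite_UN_I) auto
        ultimately have finK: "finite K" "finite (\<Union>j\<in>K. A j - ?T)" by simp_all
        have "card K + card J = card (K \<union> J)"
          using K finK finJ finT by (intro card_Un_disjoint[symmetric]) auto
        also have "\<dots> \<le> card (\<Union> (A ` (K \<union> J)))"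
          using K J(1) by (intro hall) auto
        also have "\<Union> (A ` (K \<union> J)) = (\<Union>j\<in>K. A j - ?T) \<union> ?T" by auto
        also have "card \<dots> = card (\<Union>j\<in>K. A j - ?T) + card ?T"
          using finK finJ finT by (intro card_Un_disjoint) auto
        finally show "card K \<le> card (\<Union>j\<in>K. A j - ?T)" using J(3) by simp
      qed (use fin in auto)
      then obtain g where g: "inj_on g (I - J)" "\<forall>j\<in>I - J. g j \<in> A j - ?T" by blast
      let ?h = "\<lambda>j. if j \<in> J then f j else g j"
      have "inj_on ?h I"
      proof (rule inj_onI)
        fix x y assume xy: "x \<in> I" "y \<in> I" "?h x = ?h y"
        have cross: "f x' \<noteq> g y'" if "x' \<in> J" "y' \<in> I - J" for x' y'
          using f(2) g(2) that by fastforce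
        show "x = y"
          using xy f(1) g(1) cross[of x y] cross[of y x]
          by (auto simp: inj_on_def split: if_splits)
      qed
      moreover have "\<forall>i\<in>I. ?h i \<in> A i" using f(2) g(2) by auto
      ultimately show ?thesis by blast
    qed
  qed simp
qed

text \<open>Among all covering \<open>W\<close>, one with the fewest \<open>w \<in> W\<close> such that \<open>f w \<in> W\<close> works: a \<open>v \<in> W\<close>
  with two preimages in \<open>W\<close> could be dropped or replaced by \<open>f v\<close>.\<close>

lemma sparse_covering_subset:
  fixes f :: "'a \<Rightarrow> 'a"
  assumes fin: "finite U" and nofix: "\<And>v. v \<in> U \<Longrightarrow> f v \<noteq> v"
  shows "\<exists>W\<subseteq>U. (\<forall>v\<in>U. v \<in> W \<or> (\<exists>w\<in>W. f w = v)) \<and>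
    (\<forall>v\<in>W. \<forall>a\<in>W. \<forall>b\<in>W. f a = v \<longrightarrow> f b = v \<longrightarrow> a = b)"
proof -
  define covering where "covering W \<longleftrightarrow> W \<subseteq> U \<and> (\<forall>v\<in>U. v \<in> W \<or> (\<exists>w\<in>W. f w = v))" for W
  define B where "B W = {w \<in> W. f w \<in> W}" for W
  have "covering U" by (auto simp: covering_def)
  then obtain W where W: "covering W" and min: "\<And>W'. covering W' \<Longrightarrow> card (B W) \<le> card (B W')"
    using ex_has_least_nat[of covering U "\<lambda>W. card (B W)"] by blast
  have finB: "finite (B W)"
    using W fin by (auto simp: covering_def B_def intro: finite_subset)
  have "a = b" if v: "v \<in> W" and a: "a \<in> W" "f a = v" and b: "b \<in> W" "f b = v" for v a b
  proof (rule ccontr)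
    assume ab: "a \<noteq> b"
    have WU: "W \<subseteq> U" using W by (auto simp: covering_def)
    have ne: "f v \<noteq> v" "a \<noteq> v" "b \<noteq> v" using nofix[of v] nofix[of a] nofix[of b] v a b WU by auto
    have aB: "a \<in> B W" "b \<in> B W" using a b v by (auto simp: B_def)
    show False
    proof (cases "f v \<in> U \<and> f v \<notin> W \<and> (\<forall>w\<in>W - {v}. f w \<noteq> f v)")
      \<comment> \<open>Dropping \<open>v\<close> would leave \<open>f v\<close> uncovered, so
        \<open>f v\<close> takes its place. This adds at most \<open>f v\<close> to
        \<open>B\<close>, while \<open>a\<close> and \<open>b\<close> both leave it; a single
        preimage would not force a decrease.\<close>
      case True
      let ?W = "insert (f v) (W - {v})"
      have "covering ?W"
        using W True a ne by (auto simp: covering_def)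
      then have "card (B W) \<le> card (B ?W)" by (rule min)
      also have "B ?W \<subseteq> insert (f v) (B W - {a, b})"
        using True a b by (auto simp: B_def)
      then have "card (B ?W) \<le> card (insert (f v) (B W - {a, b}))"
        using finB by (intro card_mono) auto
      also have "\<dots> \<le> Suc (card (B W - {a, b}))" by (rule card_insert_le_m1) auto
      also have "card (B W - {a, b}) = card (B W) - 2"
        using aB ab finB by (subst card_Diff_subset) auto
      also have "card (B W) \<ge> 2"
        using card_mono[OF finB, of "{a, b}"] aB ab by auto
      ultimately show False by simp
    next
      case False
      let ?W = "W - {v}"
      have "covering ?W"
        unfolding covering_def
      proof (intro conjI ballI)
        fix y assume y: "y \<in> U"
        show "y \<in> ?W \<or> (\<exists>w\<in>?W. f w = y)"
        proof (cases "y = v \<or> y \<in> W")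
          case True
          then show ?thesis using a ne by auto
        next
          case yv: False
          then obtain w where w: "w \<in> W" "f w = y" using W y by (auto simp: covering_def)
          show ?thesis
          proof (cases "w = v")
            case True
            then show ?thesis using False w y yv by auto
          qed (use w in auto)
        qed
      qed (use WU in auto)
      then have "card (B W) \<le> card (B ?W)" by (rule min)
      moreover have "card (B ?W) < card (B W)"
      proof (rule psubset_card_mono[OF finB])
        have "B ?W \<subseteq> B W" "a \<notin> B ?W" using a by (auto simp: B_def)
        then show "B ?W \<subset> B W" using aB by auto
      qed
      ultimately show False by simp
    qed
  qed
  then show ?thesis
    using W unfolding covering_def by blast
qed

text \<open>In a cover with the fewest arcs, deleting an edge other than \<open>uv\<close> uncovers
  one of its ends, whose only neighbour was therefore the other end. The edge \<open>uv\<close> is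
  exempt from deletion, hence the separate hypothesis on its ends, which passes to subrelations
  containing the edge.\<close>

lemma minimal_edge_cover:
  fixes F0 :: "'a rel"
  assumes fin: "finite F0" and sym: "sym F0" and e: "(u, v) \<in> F0"
    and cover: "\<And>x. x \<in> V \<Longrightarrow> F0 `` {x} \<noteq> {}"
    and pendant: "F0 `` {u} = {v} \<or> F0 `` {v} = {u}"
  shows "\<exists>F\<subseteq>F0. sym F \<and> (u, v) \<in> F \<and> (\<forall>x\<in>V. F `` {x} \<noteq> {}) \<and>
    (\<forall>(x, y)\<in>F. F `` {x} = {y} \<or> F `` {y} = {x})"
proof -
  define good where "good F \<longleftrightarrow> F \<subseteq> F0 \<and> sym F \<and> (u, v) \<in> F \<and> (\<forall>x\<in>V. F `` {x} \<noteq> {})" for F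
  have "good F0" using sym e cover by (auto simp: good_def)
  then obtain F where F: "good F" and min: "\<And>F'. good F' \<Longrightarrow> card F \<le> card F'"
    using ex_has_least_nat[of good F0 card] by blast
  have sub: "F \<subseteq> F0" and symF: "sym F" and uv: "(u, v) \<in> F" "(v, u) \<in> F"
    using F by (auto simp: good_def dest: symD)
  have "F `` {x} = {y} \<or> F `` {y} = {x}" if xy: "(x, y) \<in> F" for x y
  proof (cases "(x, y) = (u, v) \<or> (x, y) = (v, u)")
    case True
    have "F `` {u} = {v} \<or> F `` {v} = {u}"
      using pendant sub uv by blast
    then show ?thesis using True by auto
  next
    case False
    let ?F = "F - {(x, y), (y, x)}"
    have "card ?F < card F"
      using xy finite_subset[OF sub fin] by (intro psubset_card_mono) auto
    then have "\<not> good ?F" using min by (meson not_le)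
    moreover have "sym ?F" using symF by (auto simp: sym_def)
    moreover have "(u, v) \<in> ?F" using uv False by auto
    ultimately obtain z where z: "z \<in> V" "?F `` {z} = {}"
      using sub by (auto simp: good_def)
    moreover have "F `` {z} \<noteq> {}" using F z by (auto simp: good_def)
    moreover have "(y, x) \<in> F" using symF xy by (auto dest: symD)
    ultimately show ?thesis using xy by blast
  qed
  then show ?thesis
    using F unfolding good_def by blast
qed

section \<open>From Hall's condition to a cover of maximum degree two\<close>

context pair_graph begin

text \<open>Only the assignments starting in the sparse set \<open>W\<close> are kept. A vertex of
  \<open>W\<close> then has its own assignment and at most one incoming, a vertex of
  \<open>U\<close> outside \<open>W\<close> at most two incoming and none of its own. The shared
  slot lets at most one vertex attach to the edge \<open>uv\<close>, so one end remains a
  leaf.\<close>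

lemma ex_cover_with_arc:
  assumes uv: "(u, v) \<in> parcs G"
    and hall: "\<And>X. X \<subseteq> pverts G - {u, v} \<Longrightarrow>
      card X \<le> 2 * card (parcs G `` X - {u, v}) + (if parcs G `` X \<inter> {u, v} = {} then 0 else 1)"
  shows "\<exists>F0\<subseteq>parcs G. sym F0 \<and> (u, v) \<in> F0 \<and> (\<forall>x\<in>pverts G. F0 `` {x} \<noteq> {}) \<and>
    (\<forall>x\<in>pverts G. card (F0 `` {x}) \<le> 2) \<and> (F0 `` {u} = {v} \<or> F0 `` {v} = {u})"
proof -
  define U where "U = pverts G - {u, v}"
  have finU: "finite U" by (simp add: U_def)
  have uv_neq: "u \<noteq> v" using uv no_loops' by blast
  text \<open>The two slots of \<open>w \<in> U\<close> are \<open>(w, True)\<close> and \<open>(w, False)\<close>; the single slot shared by \<open>u\<close> and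
    \<open>v\<close> is \<open>(u, True)\<close>.\<close>
  define A where "A x = (parcs G `` {x} - {u, v}) \<times> (UNIV :: bool set) \<union>
    (if parcs G `` {x} \<inter> {u, v} = {} then {} else {(u, True)})" for x
  have fin_img: "finite (parcs G `` X)" for X
    by (rule finite_subset[OF _ pair_finite_verts]) (auto dest: in_arcsD2)
  have "\<exists>g. inj_on g U \<and> (\<forall>x\<in>U. g x \<in> A x)"
  proof (rule hall_marriage[OF finU])
    fix x show "finite (A x)" using fin_img[of "{x}"] by (simp add: A_def)
  next
    fix X assume X: "X \<subseteq> U"
    let ?N = "parcs G `` X"
    have "card X \<le> 2 * card (?N - {u, v}) + (if ?N \<inter> {u, v} = {} then 0 else 1)"
      using hall X by (simp add: U_def)
    also have "\<dots> = card ((?N - {u, v}) \<times> (UNIV :: bool set))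
        + card (if ?N \<inter> {u, v} = {} then {} else {(u, True)})"
      by (simp add: card_cartesian_product)
    also have "\<dots> = card ((?N - {u, v}) \<times> (UNIV :: bool set) \<union>
        (if ?N \<inter> {u, v} = {} then {} else {(u, True)}))"
      using fin_img[of X] by (intro card_Un_disjoint[symmetric]) auto
    also have "(?N - {u, v}) \<times> (UNIV :: bool set) \<union> (if ?N \<inter> {u, v} = {} then {} else {(u, True)})
        = \<Union> (A ` X)"
      by (fastforce simp: A_def split: if_splits)
    finally show "card X \<le> card (\<Union> (A ` X))" .
  qed
  then obtain g where g: "inj_on g U" "\<And>x. x \<in> U \<Longrightarrow> g x \<in> A x" by blast
  define f where "f x = fst (g x)" for x
  have f: "f x \<in> U \<and> (x, f x) \<in> parcs G \<or> f x = u \<and> ((x, u) \<in> parcs G \<or> (x, v) \<in> parcs G)"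
    if "x \<in> U" for x
    using g(2)[OF that] by (auto simp: A_def f_def U_def dest: in_arcsD2 split: if_splits)
  have fibre_u: "a = b" if "a \<in> U" "b \<in> U" "f a = u" "f b = u" for a b
  proof -
    have "g x = (u, True)" if "x \<in> U" "f x = u" for x
      using g(2)[OF that(1)] that(2) by (auto simp: A_def f_def split: if_splits)
    then show ?thesis using that g(1) by (metis inj_onD)
  qed
  have fibre: "card {a \<in> U. f a = x} \<le> 2" for x
  proof -
    have "g a \<in> {x} \<times> UNIV" if "f a = x" for a
      using that by (cases "g a") (simp add: f_def)
    then have sub: "g ` {a \<in> U. f a = x} \<subseteq> {x} \<times> UNIV" by blast
    have "card {a \<in> U. f a = x} = card (g ` {a \<in> U. f a = x})"
      by (rule card_image[symmetric]) (rule inj_on_subset[OF g(1)], auto)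
    also have "\<dots> \<le> card ({x} \<times> (UNIV :: bool set))"
      using sub by (rule card_mono[rotated]) simp
    finally show ?thesis by (simp add: card_cartesian_product)
  qed
  have nofix: "f x \<noteq> x" if "x \<in> U" for x
    using f[OF that] that no_loops'[of x x] by (auto simp: U_def)
  have "\<exists>W\<subseteq>U. (\<forall>x\<in>U. x \<in> W \<or> (\<exists>w\<in>W. f w = x)) \<and>
      (\<forall>x\<in>W. \<forall>a\<in>W. \<forall>b\<in>W. f a = x \<longrightarrow> f b = x \<longrightarrow> a = b)"
    by (rule sparse_covering_subset[OF finU]) (rule nofix)
  then obtain W where W: "W \<subseteq> U" and Wcov: "\<forall>x\<in>U. x \<in> W \<or> (\<exists>w\<in>W. f w = x)"
    and Winj: "\<forall>x\<in>W. \<forall>a\<in>W. \<forall>b\<in>W. f a = x \<longrightarrow> f b = x \<longrightarrow> a = b"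
    by blast
  \<comment> \<open>\<open>f x = u\<close> only records that \<open>x\<close> took the shared slot;
    \<open>h\<close> turns it into a true neighbour, \<open>u\<close> if adjacent and
    \<open>v\<close> otherwise.\<close>
  define h where "h x = (if f x \<noteq> u \<or> (x, u) \<in> parcs G then f x else v)" for x
  have h_arc: "(x, h x) \<in> parcs G" if "x \<in> W" for x
    using f[of x] that W by (auto simp: h_def U_def)
  have h_f: "h x = f x" if "h x \<in> U" for x
    using that by (auto simp: h_def U_def split: if_splits)
  have h_uv: "f x = u" if "x \<in> W" "h x = u \<or> h x = v" for x
    using f[of x] that W by (auto simp: h_def U_def split: if_splits)
  define F0 where "F0 = {(u, v), (v, u)} \<union> {(w, h w) | w. w \<in> W} \<union> {(h w, w) | w. w \<in> W}"
  have "F0 \<subseteq> parcs G"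
    using uv h_arc arcs_symmetric by (auto simp: F0_def)
  moreover have "sym F0" by (auto simp: F0_def sym_def)
  moreover have "(u, v) \<in> F0" by (simp add: F0_def)
  moreover have Fu: "F0 `` {u} = insert v {w \<in> W. h w = u}" and Fv: "F0 `` {v} = insert u {w \<in> W. h w = v}"
    using W uv_neq by (auto simp: F0_def U_def)
  have uv_one: "{w \<in> W. h w = u} = {} \<or> {w \<in> W. h w = v} = {}"
  proof (rule ccontr)
    assume "\<not> ?thesis"
    then obtain a b where ab: "a \<in> W" "h a = u" "b \<in> W" "h b = v" by auto
    then have "f a = u" "f b = u" using h_uv by blast+
    with ab W have "a = b" using fibre_u by blast
    with ab uv_neq show False by simp
  qed
  then have "F0 `` {u} = {v} \<or> F0 `` {v} = {u}"
    unfolding Fu Fv by auto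
  moreover have "F0 `` {x} \<noteq> {}" if x: "x \<in> pverts G" for x
  proof (cases "x \<in> U")
    case True
    then consider "x \<in> W" | w where "w \<in> W" "f w = x" using Wcov by blast
    then show ?thesis
    proof cases
      case (2 w)
      then have "h w = x" using True by (auto simp: h_def U_def)
      with 2(1) have "(x, w) \<in> F0" unfolding F0_def by blast
      then show ?thesis by blast
    qed (auto simp: F0_def)
  qed (use x in \<open>auto simp: F0_def U_def\<close>)
  moreover have "card (F0 `` {x}) \<le> 2" if x: "x \<in> pverts G" for x
  proof (cases "x \<in> U")
    case True
    have sub: "F0 `` {x} \<subseteq> {h w | w. w = x \<and> w \<in> W} \<union> {w \<in> W. f w = x}"
      using True h_f by (auto simp: F0_def U_def)
    show ?thesis
    proof (cases "x \<in> W")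
      case xW: True
      show ?thesis
      proof (cases "{w \<in> W. f w = x} = {}")
        case True
        then have "F0 `` {x} \<subseteq> {h x}" using sub by auto
        then have "card (F0 `` {x}) \<le> card {h x}" by (rule card_mono[rotated]) simp
        then show ?thesis by simp
      next
        case False
        then obtain a where "a \<in> W" "f a = x" by blast
        then have "{w \<in> W. f w = x} \<subseteq> {a}" using Winj xW by auto
        then have "F0 `` {x} \<subseteq> {h x, a}" using sub by auto
        then have "card (F0 `` {x}) \<le> card {h x, a}" by (rule card_mono[rotated]) simp
        also have "\<dots> \<le> 2" by (simp add: card_insert_if)
        finally show ?thesis .
      qed
    next
      case False
      then have "F0 `` {x} \<subseteq> {a \<in> U. f a = x}" using sub W by auto
      then have "card (F0 `` {x}) \<le> card {a \<in> U. f a = x}"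
        by (rule card_mono[rotated]) (simp add: finU)
      with fibre[of x] show ?thesis by linarith
    qed
  next
    case False
    have le1: "card {w \<in> W. h w = y} \<le> 1" if "y = u \<or> y = v" for y
    proof -
      have "a = b" if "a \<in> W" "b \<in> W" "h a = y" "h b = y" for a b
      proof -
        have "f a = u" "f b = u" using that \<open>y = u \<or> y = v\<close> h_uv by blast+
        with that W show ?thesis using fibre_u by blast
      qed
      moreover have "finite {w \<in> W. h w = y}" using finite_subset[OF W finU] by simp
      ultimately show ?thesis by (simp add: card_le_Suc0_iff_eq)
    qed
    have "card (insert z {w \<in> W. h w = y}) \<le> 2" if "y = u \<or> y = v" for y z
      using card_insert_le_m1[of 2 "{w \<in> W. h w = y}" z] le1[OF that] by simp
    then show ?thesis
      using False x Fu Fv by (auto simp: U_def)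
  qed
  ultimately show ?thesis by blast
qed

end

section \<open>Components of minimal edge covers\<close>

text \<open>The centre is the unique neighbour of \<open>x\<close> if \<open>x\<close> is a leaf,
  and \<open>x\<close> itself otherwise; for an isolated edge either end would do. All neighbours of
  the centre are leaves, so no arc leaves the set \<open>T\<close> of the centre and its
  neighbours.\<close>

lemma star_component:
  fixes F :: "'a rel"
  assumes pg: "pair_graph H" and F: "F = parcs H"
    and cover: "\<And>x. x \<in> pverts H \<Longrightarrow> F `` {x} \<noteq> {}"
    and pendant: "\<And>x y. (x, y) \<in> F \<Longrightarrow> F `` {x} = {y} \<or> F `` {y} = {x}"
    and C: "C \<in> components H"
  shows "\<exists>c\<in>pverts H. K\<^bsub>1,card (F `` {c})\<^esub> C \<and> F `` {c} \<noteq> {}"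
proof -
  interpret pair_graph H by (rule pg)
  have symF: "(y, x) \<in> F" if "(x, y) \<in> F" for x y
    using that arcs_symmetric by (simp add: F)
  have F_verts: "x \<in> pverts H" "y \<in> pverts H" "x \<noteq> y" if "(x, y) \<in> F" for x y
    using that in_arcsD1 in_arcsD2 no_loops' by (auto simp: F)
  obtain S where S: "S \<in> sccs_verts" and CS: "C = with_proj H \<restriction> S"
    using C sccs_conv_sccs_verts by auto
  obtain x where x: "x \<in> S" using S by (auto simp: sccs_verts_def)
  have xH: "x \<in> pverts H"
    using S x reachable_in_verts(1)[of x x] by (auto simp: sccs_verts_def)
  obtain c where c: "x \<in> insert c (F `` {c})" "\<And>z. (c, z) \<in> F \<Longrightarrow> F `` {z} = {c}" "c \<in> pverts H"
  proof (cases "\<exists>y. F `` {x} = {y}")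
    case True
    then obtain y where y: "F `` {x} = {y}" by blast
    then have "(x, y) \<in> F" by blast
    then have yx: "(y, x) \<in> F" by (rule symF)
    have "F `` {z} = {y}" if yz: "(y, z) \<in> F" for z
      using pendant[OF yz] y yx by auto
    then show ?thesis using that[of y] yx F_verts by auto
  next
    case False
    then have "F `` {z} = {x}" if "(x, z) \<in> F" for z using pendant[OF that] by blast
    then show ?thesis using that[of x] xH by auto
  qed
  define T where "T = insert c (F `` {c})"
  have T_verts: "T \<subseteq> pverts H" using c(3) F_verts by (auto simp: T_def)
  have from_c: "c \<rightarrow>\<^sup>*\<^bsub>with_proj H\<^esub> z" "z \<rightarrow>\<^sup>*\<^bsub>with_proj H\<^esub> c" if "z \<in> T" for z
    using that c(3) symF by (auto simp: T_def F intro: reachable_adjI)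
  have closed: "b \<in> T" if "(a, b) \<in> F" "a \<in> T" for a b
    using that c(2) by (auto simp: T_def)
  have stay: "b \<in> T" if "a \<rightarrow>\<^sup>*\<^bsub>with_proj H\<^esub> b" "a \<in> T" for a b
    using that
  proof (induction rule: reachable_induct)
    case (step y z)
    then show ?case using closed by (simp add: F)
  qed auto
  have T: "T \<in> sccs_verts"
    unfolding in_sccs_verts_conv_reachable
  proof (intro conjI ballI allI impI)
    fix a b assume "a \<in> T" "b \<in> T"
    then show "a \<rightarrow>\<^sup>*\<^bsub>with_proj H\<^esub> b" using from_c by (blast intro: reachable_trans)
  next
    fix a b assume "a \<in> T" "b \<notin> T"
    then show "\<not> a \<rightarrow>\<^sup>*\<^bsub>with_proj H\<^esub> b \<or> \<not> b \<rightarrow>\<^sup>*\<^bsub>with_proj H\<^esub> a" using stay by blast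
  qed (simp add: T_def)
  then have ST: "S = T" using sccs_verts_disjoint[OF S T] x c(1) by (auto simp: T_def)
  define K where "K = \<lparr> pverts = T, parcs = {c} \<times> F `` {c} \<union> F `` {c} \<times> {c} \<rparr>"
  have "b = c" if "(a, b) \<in> F" "(c, a) \<in> F" for a b
    using c(2)[OF that(2)] that(1) by blast
  then have "{e \<in> parcs H. fst e \<in> T \<and> snd e \<in> T} = parcs K"
    using symF by (fastforce simp: K_def T_def F)
  then have "C = with_proj K"
    by (simp add: CS ST induce_subgraph_def with_proj_def K_def)
  moreover have "K\<^bsub>1,card (F `` {c})\<^esub> (with_proj K)"
    unfolding complete_bipartite_digraph_pair_def
  proof (rule conjI)
    show "finite (pverts K)" using finite_subset[OF T_verts pair_finite_verts] by (simp add: K_def)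
    show "\<exists>U V. pverts K = U \<union> V \<and> U \<inter> V = {} \<and> card U = 1 \<and> card V = card (F `` {c}) \<and>
        parcs K = U \<times> V \<union> V \<times> U"
      by (rule exI[of _ "{c}"], rule exI[of _ "F `` {c}"]) (use F_verts(3) in \<open>auto simp: K_def T_def\<close>)
  qed
  ultimately show ?thesis using c(3) cover by blast
qed

lemma star_factor_of_cover:
  assumes pg: "pair_graph G" and sub: "F \<subseteq> parcs G" and sym: "sym F"
    and cover: "\<And>x. x \<in> pverts G \<Longrightarrow> F `` {x} \<noteq> {}"
    and deg: "\<And>x. x \<in> pverts G \<Longrightarrow> card (F `` {x}) \<le> 2"
    and pendant: "\<And>x y. (x, y) \<in> F \<Longrightarrow> F `` {x} = {y} \<or> F `` {y} = {x}"
    and e: "e \<in> F" and k: "k \<ge> 2"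
  shows "\<exists>H. star_factor k H G \<and> (\<exists>C\<in>components H. e \<in> arcs C \<and> (K\<^bsub>1,1\<^esub> C \<or> K\<^bsub>1,2\<^esub> C))"
proof -
  interpret G: pair_graph G by (rule pg)
  define H where "H = \<lparr> pverts = pverts G, parcs = F \<rparr>"
  have pH: "pair_graph H"
  proof
    show "finite (parcs H)" using finite_subset[OF sub G.pair_finite_arcs] by (simp add: H_def)
    show "symmetric (with_proj H)" using sym by (simp add: H_def symmetric_def)
  qed (use sub G.in_arcsD1 G.in_arcsD2 G.no_loops' in \<open>auto simp: H_def\<close>)
  then interpret H: pair_graph H .
  have "factor H G"
    using pH sub by (auto simp: factor_def spanning_def subgraph_def compatible_def H_def
        intro: G.wf_digraph_axioms H.wf_digraph_axioms[unfolded H_def])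
  moreover have star: "K\<^bsub>1,1\<^esub> C \<or> K\<^bsub>1,2\<^esub> C" if C: "C \<in> components H" for C
  proof -
    obtain c where c: "c \<in> pverts H" "K\<^bsub>1,card (F `` {c})\<^esub> C" "F `` {c} \<noteq> {}"
      using star_component[OF pH _ _ _ C, of F] cover pendant by (auto simp: H_def)
    have "finite (F `` {c})"
      using finite_subset[OF sub G.pair_finite_arcs] by (rule finite_Image)
    then have "card (F `` {c}) \<noteq> 0" using c(3) by simp
    moreover have "card (F `` {c}) \<le> 2" using c(1) deg by (simp add: H_def)
    ultimately have "card (F `` {c}) = 1 \<or> card (F `` {c}) = 2" by linarith
    with c(2) show ?thesis by auto
  qed
  ultimately have "star_factor k H G"
    using k unfolding star_factor_def by (meson le_refl one_le_numeral order_trans)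
  moreover obtain a b where ab: "e = (a, b)" by (cases e)
  have reach: "a \<rightarrow>\<^sup>*\<^bsub>with_proj H\<^esub> a" "a \<rightarrow>\<^sup>*\<^bsub>with_proj H\<^esub> b"
    using e H.in_arcsD1[of a b] H.reachable_refl[of a] H.reachable_adjI[of a b] by (simp_all add: ab H_def)
  \<comment> \<open>Arcs are symmetric, so the strong component of \<open>a\<close> is simply
    everything reachable from it.\<close>
  have "(with_proj H \<restriction> {v. a \<rightarrow>\<^sup>*\<^bsub>with_proj H\<^esub> v}) \<in> components H"
    using H.in_arcsD1[of a b] e by (intro H.induce_reachable_is_in_sccs) (auto simp: ab H_def)
  moreover have "e \<in> arcs (with_proj H \<restriction> {v. a \<rightarrow>\<^sup>*\<^bsub>with_proj H\<^esub> v})"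
    using e reach by (simp add: ab H_def)
  ultimately show ?thesis using star by blast
qed

section \<open>The signless Laplacian\<close>

text \<open>Acting on functions of vertices removes the enumeration. The ring is left open because
  an eigenvalue is first found over the complex numbers and then used over the reals.\<close>

definition signless_laplacian :: "'a pair_pre_digraph \<Rightarrow> ('a \<Rightarrow> 'b::comm_ring_1) \<Rightarrow> 'a \<Rightarrow> 'b" where
  "signless_laplacian G z v =
    of_nat (out_degree (with_proj G) v) * z v + (\<Sum>w | (v, w) \<in> parcs G. z w)"

definition signless_matrix :: "'a pair_pre_digraph \<Rightarrow> 'a list \<Rightarrow> 'b::comm_ring_1 mat" where
  "signless_matrix G vs = mat (length vs) (length vs)
    (\<lambda>(i, j). (if i = j then of_nat (out_degree (with_proj G) (vs ! i)) else 0)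
      + (if (vs ! i, vs ! j) \<in> parcs G then 1 else 0))"

lemma signless_matrix_real:
  "degree_matrix G vs + adjacency_matrix G vs = signless_matrix G vs"
  by (rule eq_matI) (auto simp: degree_matrix_def adjacency_matrix_def signless_matrix_def)

lemma (in pair_graph) out_degree_eq_card:
  "out_degree (with_proj G) v = card {w. (v, w) \<in> parcs G}"
proof -
  have "bij_betw snd (out_arcs (with_proj G) v) {w. (v, w) \<in> parcs G}"
    by (rule bij_betwI[where g = "\<lambda>w. (v, w)"]) (auto simp: out_arcs_def)
  then show ?thesis
    by (simp add: out_degree_def bij_betw_same_card)
qed

lemma (in pair_graph) finite_neighbours [simp]: "finite {w. (v, w) \<in> parcs G}"
  by (rule finite_subset[OF _ pair_finite_verts]) (auto dest: in_arcsD2)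

text \<open>In this form every arc contributes separately, so for positive \<open>z\<close> a larger
  set of neighbours gives a larger value.\<close>

lemma (in pair_graph) signless_laplacian_eq_sum:
  "signless_laplacian G z v = (\<Sum>w | (v, w) \<in> parcs G. z v + z w)"
  by (simp add: signless_laplacian_def out_degree_eq_card sum.distrib)

lemma (in pair_graph) signless_matrix_mult:
  assumes vs: "distinct vs" "set vs = pverts G" and i: "i < length vs"
    and x: "x \<in> carrier_vec (length vs)" and z: "\<And>j. j < length vs \<Longrightarrow> z (vs ! j) = x $ j"
  shows "(signless_matrix G vs *\<^sub>v x) $ i = signless_laplacian G z (vs ! i)"
proof -
  let ?n = "length vs"
  have bij: "bij_betw (\<lambda>j. vs ! j) {0..<?n} (pverts G)"
    using vs bij_betw_nth[of vs "{0..<?n}" "pverts G"] by (simp add: atLeast0LessThan)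
  have "(\<Sum>j\<in>{0..<?n}. (if (vs ! i, vs ! j) \<in> parcs G then 1 else 0) * x $ j)
      = (\<Sum>j\<in>{0..<?n}. if (vs ! i, vs ! j) \<in> parcs G then z (vs ! j) else 0)"
    by (rule sum.cong) (auto simp: z)
  also have "\<dots> = (\<Sum>w\<in>pverts G. if (vs ! i, w) \<in> parcs G then z w else 0)"
    by (rule sum.reindex_bij_betw[OF bij])
  also have "\<dots> = (\<Sum>w\<in>{w \<in> pverts G. (vs ! i, w) \<in> parcs G}. z w)"
    by (rule sum.inter_filter[symmetric]) simp
  also have "{w \<in> pverts G. (vs ! i, w) \<in> parcs G} = {w. (vs ! i, w) \<in> parcs G}"
    by (auto dest: in_arcsD2)
  finally have adj: "(\<Sum>j\<in>{0..<?n}. (if (vs ! i, vs ! j) \<in> parcs G then 1 else 0) * x $ j)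
      = (\<Sum>w | (vs ! i, w) \<in> parcs G. z w)" .
  have deg: "(\<Sum>j\<in>{0..<?n}. (if i = j then of_nat (out_degree (with_proj G) (vs ! i)) else 0) * x $ j)
      = of_nat (out_degree (with_proj G) (vs ! i)) * z (vs ! i)"
    using i z[of i] by (simp add: if_distrib[of "\<lambda>a. a * _"] sum.delta cong: if_cong)
  show ?thesis
    using i x unfolding signless_laplacian_def adj[symmetric] deg[symmetric] sum.distrib[symmetric]
    by (simp add: signless_matrix_def scalar_prod_def distrib_right)
qed

text \<open>The right-hand side does not mention \<open>vs\<close>, so the arbitrary choice of an
  enumeration in \<open>q_index\<close> is harmless.\<close>

lemma (in pair_graph) eigenvalue_signless_matrix_iff:
  fixes \<mu> :: "'b::comm_ring_1"
  assumes vs: "distinct vs" "set vs = pverts G"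
  shows "eigenvalue (signless_matrix G vs) \<mu> \<longleftrightarrow>
    (\<exists>z. (\<exists>v\<in>pverts G. z v \<noteq> 0) \<and> (\<forall>v\<in>pverts G. signless_laplacian G z v = \<mu> * z v))"
proof
  let ?n = "length vs" and ?Q = "signless_matrix G vs :: 'b mat"
  have dim: "dim_row ?Q = ?n" "dim_col ?Q = ?n" by (simp_all add: signless_matrix_def)
  assume "eigenvalue ?Q \<mu>"
  then obtain x where x: "x \<in> carrier_vec ?n" "x \<noteq> 0\<^sub>v ?n" "?Q *\<^sub>v x = \<mu> \<cdot>\<^sub>v x"
    by (auto simp: eigenvalue_def eigenvector_def dim)
  define z where "z v = x $ (the_inv_into {..<?n} (\<lambda>j. vs ! j) v)" for v
  have inj: "inj_on (\<lambda>j. vs ! j) {..<?n}"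
    using vs by (auto simp: inj_on_def nth_eq_iff_index_eq)
  have z: "z (vs ! j) = x $ j" if "j < ?n" for j
    using that by (simp add: z_def the_inv_into_f_f[OF inj])
  have "signless_laplacian G z v = \<mu> * z v" if v: "v \<in> pverts G" for v
  proof -
    obtain i where i: "i < ?n" "v = vs ! i" using v vs(2) by (metis in_set_conv_nth)
    show ?thesis
      using signless_matrix_mult[OF vs i(1) x(1) z] x(1) x(3) z[OF i(1)] i by simp
  qed
  moreover obtain j where j: "j < ?n" "x $ j \<noteq> 0"
    using x(1,2) by (metis carrier_vecD eq_vecI index_zero_vec(1) index_zero_vec(2))
  then have "vs ! j \<in> pverts G" "z (vs ! j) \<noteq> 0"
    using vs(2) z by auto
  ultimately show "\<exists>z. (\<exists>v\<in>pverts G. z v \<noteq> 0) \<and> (\<forall>v\<in>pverts G. signless_laplacian G z v = \<mu> * z v)"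
    by blast
next
  let ?n = "length vs" and ?Q = "signless_matrix G vs :: 'b mat"
  have dim: "dim_row ?Q = ?n" "dim_col ?Q = ?n" by (simp_all add: signless_matrix_def)
  assume "\<exists>z. (\<exists>v\<in>pverts G. z v \<noteq> 0) \<and> (\<forall>v\<in>pverts G. signless_laplacian G z v = \<mu> * z v)"
  then obtain z where z: "\<exists>v\<in>pverts G. z v \<noteq> 0"
      "\<And>v. v \<in> pverts G \<Longrightarrow> signless_laplacian G z v = \<mu> * z v"
    by blast
  define x where "x = vec ?n (\<lambda>i. z (vs ! i))"
  have "?Q *\<^sub>v x = \<mu> \<cdot>\<^sub>v x"
  proof (rule eq_vecI)
    fix i assume "i < dim_vec (\<mu> \<cdot>\<^sub>v x)"
    then have i: "i < ?n" by (simp add: x_def)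
    have "x \<in> carrier_vec ?n" "\<And>j. j < ?n \<Longrightarrow> z (vs ! j) = x $ j"
      by (simp_all add: x_def)
    then have "(?Q *\<^sub>v x) $ i = signless_laplacian G z (vs ! i)"
      using signless_matrix_mult[OF vs i, of x z] by blast
    also have "\<dots> = \<mu> * z (vs ! i)"
      using z(2)[of "vs ! i"] vs(2) i by (metis nth_mem)
    finally show "(?Q *\<^sub>v x) $ i = (\<mu> \<cdot>\<^sub>v x) $ i"
      using i by (simp add: x_def)
  qed (simp add: dim x_def)
  moreover obtain i where "i < ?n" "z (vs ! i) \<noteq> 0"
    using z(1) vs(2) by (metis in_set_conv_nth)
  then have "x $ i \<noteq> 0\<^sub>v ?n $ i" by (simp add: x_def)
  then have "x \<noteq> 0\<^sub>v ?n" by auto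
  ultimately have "eigenvector ?Q x \<mu>"
    by (simp add: eigenvector_def dim x_def)
  then show "eigenvalue ?Q \<mu>"
    by (auto simp: eigenvalue_def)
qed

section \<open>Real spectrum and the index\<close>

lemma (in pair_graph) signless_laplacian_symmetric:
  "(\<Sum>v\<in>pverts G. x v * signless_laplacian G y v) = (\<Sum>v\<in>pverts G. y v * signless_laplacian G x v)"
proof -
  have *: "(\<Sum>w | (v, w) \<in> parcs G. h w) = (\<Sum>w\<in>pverts G. if (v, w) \<in> parcs G then h w else 0)"
    for h :: "'a \<Rightarrow> 'b" and v
    unfolding sum.inter_filter[OF pair_finite_verts, symmetric]
    by (rule sum.cong) (auto dest: in_arcsD2)
  have "(\<Sum>v\<in>pverts G. \<Sum>w | (v, w) \<in> parcs G. x v * y w)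
      = (\<Sum>v\<in>pverts G. \<Sum>w\<in>pverts G. if (v, w) \<in> parcs G then x v * y w else 0)"
    by (simp only: *)
  also have "\<dots> = (\<Sum>w\<in>pverts G. \<Sum>v\<in>pverts G. if (v, w) \<in> parcs G then x v * y w else 0)"
    by (rule sum.swap)
  also have "\<dots> = (\<Sum>w\<in>pverts G. \<Sum>v\<in>pverts G. if (w, v) \<in> parcs G then y w * x v else 0)"
    by (intro sum.cong refl) (auto simp: mult.commute dest: arcs_symmetric)
  also have "\<dots> = (\<Sum>v\<in>pverts G. \<Sum>w | (v, w) \<in> parcs G. y v * x w)"
    by (simp only: *)
  finally show ?thesis
    by (simp add: signless_laplacian_def distrib_left sum.distrib sum_distrib_left mult.left_commute
        mult.commute)
qed

text \<open>A complex eigenvector of a real symmetric operator has real eigenvalue, so its real or its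
  imaginary part is a real eigenvector.\<close>

lemma (in pair_graph) ex_real_eigenvalue:
  assumes vs: "distinct vs" "set vs = pverts G" and ne: "pverts G \<noteq> {}"
  shows "\<exists>\<mu>::real. eigenvalue (signless_matrix G vs) \<mu>"
proof -
  have "signless_matrix G vs \<in> carrier_mat (length vs) (length vs)"
    by (simp add: signless_matrix_def)
  moreover have "length vs > 0"
    using vs ne by auto
  ultimately have "spectrum (signless_matrix G vs :: complex mat) \<noteq> {}"
    by (rule spectrum_non_empty)
  then obtain \<mu> :: complex where "eigenvalue (signless_matrix G vs) \<mu>"
    by (auto simp: spectrum_def)
  then obtain z where nz: "\<exists>v\<in>pverts G. z v \<noteq> 0"
    and z: "\<And>v. v \<in> pverts G \<Longrightarrow> signless_laplacian G z v = \<mu> * z v"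
    unfolding eigenvalue_signless_matrix_iff[OF vs] by blast
  define x y where "x v = Re (z v)" and "y v = Im (z v)" for v
  have Re: "Re (signless_laplacian G z v) = signless_laplacian G x v"
    and Im: "Im (signless_laplacian G z v) = signless_laplacian G y v" for v
    by (simp_all add: signless_laplacian_def x_def y_def)
  have x: "signless_laplacian G x v = Re \<mu> * x v - Im \<mu> * y v"
    and y: "signless_laplacian G y v = Im \<mu> * x v + Re \<mu> * y v" if "v \<in> pverts G" for v
    using z[OF that] Re[of v] Im[of v] by (simp_all add: x_def y_def)
  \<comment> \<open>Pairing \<open>x\<close> with the image of \<open>y\<close> and \<open>y\<close>
    with the image of \<open>x\<close> gives the same number by symmetry; the eigenvalue equations
    make the difference \<open>Im \<mu>\<close> times a sum of squares.\<close>
  have "(\<Sum>v\<in>pverts G. x v * (Im \<mu> * x v + Re \<mu> * y v)) = (\<Sum>v\<in>pverts G. x v * signless_laplacian G y v)"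
    by (simp add: y)
  also have "\<dots> = (\<Sum>v\<in>pverts G. y v * signless_laplacian G x v)"
    by (rule signless_laplacian_symmetric)
  also have "\<dots> = (\<Sum>v\<in>pverts G. y v * (Re \<mu> * x v - Im \<mu> * y v))"
    by (simp add: x)
  finally have "(\<Sum>v\<in>pverts G. x v * (Im \<mu> * x v + Re \<mu> * y v) - y v * (Re \<mu> * x v - Im \<mu> * y v)) = 0"
    by (simp add: sum_subtractf)
  also have "(\<Sum>v\<in>pverts G. x v * (Im \<mu> * x v + Re \<mu> * y v) - y v * (Re \<mu> * x v - Im \<mu> * y v))
      = Im \<mu> * (\<Sum>v\<in>pverts G. (x v)\<^sup>2 + (y v)\<^sup>2)"
    unfolding sum_distrib_left by (rule sum.cong) (auto simp: algebra_simps power2_eq_square)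
  finally have *: "Im \<mu> * (\<Sum>v\<in>pverts G. (x v)\<^sup>2 + (y v)\<^sup>2) = 0" .
  obtain a where a: "a \<in> pverts G" "z a \<noteq> 0" using nz by blast
  then have "(x a)\<^sup>2 + (y a)\<^sup>2 > 0"
    by (simp add: x_def y_def complex_eq_iff sum_power2_gt_zero_iff)
  then have "(\<Sum>v\<in>pverts G. (x v)\<^sup>2 + (y v)\<^sup>2) > 0"
    using a by (intro sum_pos2[of _ a]) auto
  with * have "Im \<mu> = 0" by simp
  with x y have ev: "signless_laplacian G x v = Re \<mu> * x v" "signless_laplacian G y v = Re \<mu> * y v"
    if "v \<in> pverts G" for v
    using that by auto
  have "x a \<noteq> 0 \<or> y a \<noteq> 0"
    using a by (auto simp: x_def y_def complex_eq_iff)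
  then have "eigenvalue (signless_matrix G vs) (Re \<mu>)"
    unfolding eigenvalue_signless_matrix_iff[OF vs] using ev a by blast
  then show ?thesis ..
qed

text \<open>\<open>Max\<close> says something only about a finite nonempty set: finiteness is
  recorded here, nonemptiness comes from \<open>ex_real_eigenvalue\<close>.\<close>

lemma (in pair_graph) spectrum_signless:
  obtains vs where "distinct vs" "set vs = pverts G"
    "q_index G = Max {\<mu>. eigenvalue (signless_matrix G vs) \<mu>}"
    "finite {\<mu>::real. eigenvalue (signless_matrix G vs) \<mu>}"
proof -
  define vs where "vs = (SOME vs. distinct vs \<and> set vs = pverts G)"
  have vs: "distinct vs \<and> set vs = pverts G"
    unfolding vs_def by (rule someI_ex) (use finite_distinct_list[OF pair_finite_verts] in blast)
  have "q_index G = Max {\<mu>. eigenvalue (signless_matrix G vs) \<mu>}"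
    by (simp add: q_index_def vs_def signless_matrix_real spectrum_def)
  moreover have "finite {\<mu>::real. eigenvalue (signless_matrix G vs) \<mu>}"
    unfolding spectrum_def[symmetric] by (rule card_finite_spectrum) (auto simp: signless_matrix_def)
  ultimately show thesis
    using vs by (intro that) auto
qed

lemma (in pair_graph) q_index_eigenvector:
  assumes "pverts G \<noteq> {}"
  shows "\<exists>z. (\<exists>v\<in>pverts G. z v \<noteq> 0) \<and>
    (\<forall>v\<in>pverts G. signless_laplacian G z v = q_index G * z v)"
proof -
  obtain vs where vs: "distinct vs" "set vs = pverts G"
    "q_index G = Max {\<mu>. eigenvalue (signless_matrix G vs) \<mu>}"
    "finite {\<mu>::real. eigenvalue (signless_matrix G vs) \<mu>}"
    by (rule spectrum_signless)
  have "{\<mu>::real. eigenvalue (signless_matrix G vs) \<mu>} \<noteq> {}"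
    using ex_real_eigenvalue[OF vs(1,2) assms] by blast
  then have "q_index G \<in> {\<mu>. eigenvalue (signless_matrix G vs) \<mu>}"
    unfolding vs(3) using vs(4) by (intro Max_in)
  then show ?thesis
    unfolding mem_Collect_eq eigenvalue_signless_matrix_iff[OF vs(1,2)] .
qed

section \<open>Lower and upper bounds for the index\<close>

lemma (in pair_graph) q_index_ge:
  fixes \<mu> :: real
  assumes "\<exists>v\<in>pverts G. z v \<noteq> 0" "\<And>v. v \<in> pverts G \<Longrightarrow> signless_laplacian G z v = \<mu> * z v"
  shows "\<mu> \<le> q_index G"
proof -
  obtain vs where vs: "distinct vs" "set vs = pverts G"
    "q_index G = Max {\<mu>. eigenvalue (signless_matrix G vs) \<mu>}"
    "finite {\<mu>::real. eigenvalue (signless_matrix G vs) \<mu>}"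
    by (rule spectrum_signless)
  have "eigenvalue (signless_matrix G vs) \<mu>"
    unfolding eigenvalue_signless_matrix_iff[OF vs(1,2)] using assms by blast
  then show ?thesis unfolding vs(3) using vs(4) by (intro Max_ge) auto
qed

text \<open>At a vertex \<open>v\<close> maximising \<open>\<bar>z v\<bar> / x v\<close> the eigenvalue equation bounds the eigenvalue; no
  Perron vector of \<open>G\<close> itself is needed.\<close>

lemma (in pair_graph) eigenvector_maximum:
  fixes z x :: "'a \<Rightarrow> real" and \<mu> :: real
  assumes nz: "\<exists>v\<in>pverts G. z v \<noteq> 0"
    and z: "\<And>v. v \<in> pverts G \<Longrightarrow> signless_laplacian G z v = \<mu> * z v"
    and x: "\<And>v. v \<in> pverts G \<Longrightarrow> x v > 0"
  shows "\<exists>t::real. t > 0 \<and> (\<exists>v\<in>pverts G. \<bar>z v\<bar> = t * x v) \<and> (\<forall>v\<in>pverts G. \<bar>z v\<bar> \<le> t * x v) \<and>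
    (\<forall>v\<in>pverts G. \<bar>z v\<bar> = t * x v \<longrightarrow>
      \<mu> * (t * x v) \<le> (\<Sum>w | (v, w) \<in> parcs G. \<bar>z v\<bar> + \<bar>z w\<bar>))"
proof -
  define t where "t = Max ((\<lambda>v. \<bar>z v\<bar> / x v) ` pverts G)"
  have ne: "pverts G \<noteq> {}" using nz by blast
  have "t \<in> (\<lambda>v. \<bar>z v\<bar> / x v) ` pverts G"
    unfolding t_def using ne by (intro Max_in) auto
  then have t1: "\<exists>v\<in>pverts G. \<bar>z v\<bar> = t * x v"
    using x by (force simp: field_simps)
  have le: "\<bar>z v\<bar> / x v \<le> t" if "v \<in> pverts G" for v
    unfolding t_def using that by (intro Max_ge) auto
  have t2: "\<bar>z v\<bar> \<le> t * x v" if "v \<in> pverts G" for v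
    using le[OF that] x[OF that] by (simp add: field_simps)
  obtain a where a: "a \<in> pverts G" "z a \<noteq> 0" using nz by blast
  then have "0 < \<bar>z a\<bar> / x a" using x by simp
  then have t: "t > 0" using le[OF a(1)] by linarith
  have "\<mu> * (t * x v) \<le> (\<Sum>w | (v, w) \<in> parcs G. \<bar>z v\<bar> + \<bar>z w\<bar>)"
    if v: "v \<in> pverts G" and max: "\<bar>z v\<bar> = t * x v" for v
  proof -
    have "\<mu> * (t * x v) \<le> \<bar>\<mu>\<bar> * \<bar>z v\<bar>"
      unfolding max[symmetric] by (intro mult_right_mono) auto
    also have "\<dots> = \<bar>signless_laplacian G z v\<bar>"
      using z[OF v] by (simp add: abs_mult)
    also have "\<dots> \<le> (\<Sum>w | (v, w) \<in> parcs G. \<bar>z v + z w\<bar>)"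
      unfolding signless_laplacian_eq_sum by (rule sum_abs)
    also have "\<dots> \<le> (\<Sum>w | (v, w) \<in> parcs G. \<bar>z v\<bar> + \<bar>z w\<bar>)"
      by (intro sum_mono abs_triangle_ineq)
    finally show ?thesis .
  qed
  with t t1 t2 show ?thesis by blast
qed

text \<open>The Collatz-Wielandt upper bound. Where the ratio of |z| to \<open>x\<close> attains its
  maximum \<open>t\<close>, all neighbours satisfy |z| \<le> \<open>t * x\<close>, so the row of
  \<open>z\<close> is at most \<open>t\<close> times the row of \<open>x\<close>.\<close>

lemma (in pair_graph) q_index_le:
  fixes x :: "'a \<Rightarrow> real"
  assumes ne: "pverts G \<noteq> {}" and x: "\<And>v. v \<in> pverts G \<Longrightarrow> x v > 0"
    and c: "\<And>v. v \<in> pverts G \<Longrightarrow> signless_laplacian G x v \<le> c * x v"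
  shows "q_index G \<le> c"
proof -
  obtain z where z: "\<exists>v\<in>pverts G. z v \<noteq> 0"
    "\<And>v. v \<in> pverts G \<Longrightarrow> signless_laplacian G z v = q_index G * z v"
    using q_index_eigenvector[OF ne] by blast
  have "\<exists>t>0. (\<exists>v\<in>pverts G. \<bar>z v\<bar> = t * x v) \<and> (\<forall>v\<in>pverts G. \<bar>z v\<bar> \<le> t * x v) \<and>
    (\<forall>v\<in>pverts G. \<bar>z v\<bar> = t * x v \<longrightarrow>
      q_index G * (t * x v) \<le> (\<Sum>w | (v, w) \<in> parcs G. \<bar>z v\<bar> + \<bar>z w\<bar>))"
    by (rule eigenvector_maximum[OF z(1)]) (use z x in auto)
  then obtain t where t: "t > 0" "\<exists>v\<in>pverts G. \<bar>z v\<bar> = t * x v"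
    and le: "\<forall>v\<in>pverts G. \<bar>z v\<bar> \<le> t * x v"
    and max: "\<forall>v\<in>pverts G. \<bar>z v\<bar> = t * x v \<longrightarrow>
      q_index G * (t * x v) \<le> (\<Sum>w | (v, w) \<in> parcs G. \<bar>z v\<bar> + \<bar>z w\<bar>)"
    by (elim exE conjE)
  obtain v where v: "v \<in> pverts G" "\<bar>z v\<bar> = t * x v" using t(2) by blast
  have "q_index G * (t * x v) \<le> (\<Sum>w | (v, w) \<in> parcs G. \<bar>z v\<bar> + \<bar>z w\<bar>)" using max v by blast
  also have "\<dots> \<le> (\<Sum>w | (v, w) \<in> parcs G. t * (x v + x w))"
  proof (rule sum_mono)
    fix w assume "w \<in> {w. (v, w) \<in> parcs G}"
    then have "\<bar>z w\<bar> \<le> t * x w" using le by (auto dest: in_arcsD2)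
    then show "\<bar>z v\<bar> + \<bar>z w\<bar> \<le> t * (x v + x w)" by (simp add: v(2) distrib_left)
  qed
  also have "\<dots> = t * signless_laplacian G x v"
    by (simp only: signless_laplacian_eq_sum sum_distrib_left)
  also have "\<dots> \<le> t * (c * x v)"
    using t(1) c[OF v(1)] by simp
  finally have "q_index G * (t * x v) \<le> c * (t * x v)" by (simp add: mult.left_commute)
  then show ?thesis using t(1) x[OF v(1)] by simp
qed

section \<open>The extremal graph\<close>

text \<open>The equation is the first row of the quotient eigenvalue problem of the extremal graph, with
  the eigenvector scaled to 1 on \<open>K\<^sub>2\<close>.\<close>

lemma ex_dominant_root:
  assumes n: "n \<ge> 10"
  shows "\<exists>l>2 * real n - 6 + 4 / real n.
    l = real n + 4 / (l - 2) + 2 * (real n - 4) / (l - 2 * real n + 8)"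
proof -
  define N where "N = real n"
  have N: "N \<ge> 10" using n by (simp add: N_def)
  \<comment> \<open>Setting l = 2N - 6 + d in the equation and expanding for small d gives d = 4/N
    to leading order. The root lies slightly above, which makes \<open>g ?a\<close>
    negative.\<close>
  let ?a = "2 * N - 6 + 4 / N"
  define g where "g l = l - N - 4 / (l - 2) - 2 * (N - 4) / (l - 2 * N + 8)" for l
  have aN: "0 < 4 / N" "4 / N \<le> 1" using N by simp_all
  have "g ?a < 0"
  proof -
    have "2 * (N - 4) / (?a - 2 * N + 8) = N * (N - 4) / (N + 2)"
      using N by (simp add: field_simps)
    moreover have "(N - 6 + 4 / N) * (N + 2) < N * (N - 4)"
      using N by (simp add: field_simps)
    then have "N - 6 + 4 / N < N * (N - 4) / (N + 2)"
      using N by (simp add: pos_less_divide_eq)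
    moreover have "?a - 2 > 0" using N aN by linarith
    then have "4 / (?a - 2) > 0" by (rule divide_pos_pos[rotated]) simp
    ultimately show ?thesis unfolding g_def by linarith
  qed
  moreover have "g (2 * N) \<ge> 0"
  proof -
    define d where "d = 4 / (2 * N - 2)"
    have "g (2 * N) = 2 * N - N - d - 2 * (N - 4) / 8"
      by (simp add: g_def d_def)
    moreover have "d \<le> 1" using N by (simp add: d_def)
    ultimately show ?thesis using N by simp
  qed
  moreover have "x - 2 \<noteq> 0 \<and> x - 2 * N + 8 \<noteq> 0" if "x \<in> {?a..2 * N}" for x
  proof -
    have "?a \<le> x" using that by simp
    then have "x > 2 * N - 6" using aN(1) by linarith
    then show ?thesis using N by linarith
  qed
  then have "continuous_on {?a..2 * N} g"
    unfolding g_def by (intro continuous_intros) blast+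
  moreover have "?a \<le> 2 * N" using aN by linarith
  ultimately obtain l where l: "?a \<le> l" "l \<le> 2 * N" "g l = 0"
    using IVT'[of g ?a 0 "2 * N"] less_imp_le by blast
  have "l \<noteq> ?a" using l(3) \<open>g ?a < 0\<close> by auto
  then have "l > ?a" using l(1) by simp
  moreover have "l = N + 4 / (l - 2) + 2 * (N - 4) / (l - 2 * N + 8)"
    using l(3) by (simp add: g_def)
  ultimately show ?thesis unfolding N_def by blast
qed

text \<open>The arcs of \<open>K\<^sub>2 \<or> (2 K\<^sub>1 \<union> K\<^bsub>n-4\<^esub>)\<close> on the vertex set \<open>V\<close>, where \<open>S\<close> carries
  \<open>K\<^sub>2\<close> and \<open>T\<close> carries \<open>2 K\<^sub>1\<close>.\<close>

definition split_arcs :: "'a set \<Rightarrow> 'a set \<Rightarrow> 'a set \<Rightarrow> 'a rel" where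
  "split_arcs V S T = {(x, y). x \<in> V \<and> y \<in> V \<and> x \<noteq> y \<and> (x \<in> T \<longrightarrow> y \<in> S) \<and> (y \<in> T \<longrightarrow> x \<in> S)}"

text \<open>The rows of \<open>T\<close> and of the remaining vertices read
  \<open>l * a = 2 * (a + 1)\<close> and \<open>l * c = 2 * (c + 1) + 2 * (n - 5) * c\<close>;
  solving them for \<open>a\<close> and \<open>c\<close> gives the two fractions. The row of
  \<open>S\<close> is then the equation imposed on \<open>l\<close>.\<close>

definition split_weight :: "nat \<Rightarrow> real \<Rightarrow> 'a set \<Rightarrow> 'a set \<Rightarrow> 'a \<Rightarrow> real" where
  "split_weight n l S T w =
    (if w \<in> S then 1 else if w \<in> T then 2 / (l - 2) else 2 / (l - 2 * real n + 8))"

lemma split_weight_row_sum: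
  assumes fin: "finite V" and ST: "S \<subseteq> V" "T \<subseteq> V" "S \<inter> T = {}"
    and card: "card S = 2" "card T = 2" "card V = n"
    and n: "n \<ge> 10" and l: "l > 2 * real n - 6"
      "l = real n + 4 / (l - 2) + 2 * (real n - 4) / (l - 2 * real n + 8)"
    and v: "v \<in> V"
  shows "(\<Sum>w | (v, w) \<in> split_arcs V S T. split_weight n l S T v + split_weight n l S T w)
    = l * split_weight n l S T v"
proof -
  let ?x = "split_weight n l S T"
  define \<alpha> \<gamma> where "\<alpha> = 2 / (l - 2)" and "\<gamma> = 2 / (l - 2 * real n + 8)"
  define R where "R = V - S - T"
  have \<alpha>: "\<alpha> * (l - 2) = 2" and \<gamma>: "\<gamma> * (l - 2 * real n + 8) = 2"
  proof -
    have "l - 2 \<noteq> 0" "l - 2 * real n + 8 \<noteq> 0" using n l(1) by linarith+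
    moreover have "2 / d * d = 2" if "d \<noteq> 0" for d :: real
      using that by simp
    ultimately show "\<alpha> * (l - 2) = 2" "\<gamma> * (l - 2 * real n + 8) = 2"
      unfolding \<alpha>_def \<gamma>_def by blast+
  qed
  have eq: "l = real n + 2 * \<alpha> + (real n - 4) * \<gamma>"
    using l(2) by (simp add: \<alpha>_def \<gamma>_def mult.commute)
  have finS: "finite S" "finite T" "finite R"
    using ST fin by (auto simp: R_def intro: finite_subset)
  have V: "V = S \<union> (T \<union> R)" using ST by (auto simp: R_def)
  have disj: "S \<inter> (T \<union> R) = {}" "T \<inter> R = {}" "S \<inter> R = {}" using ST by (auto simp: R_def)
  have "card V = card S + (card T + card R)"
    unfolding V using finS disj by (subst card_Un_disjoint; simp)+
  then have cR: "real (card R) = real n - 4" using card n by simp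
  have sum_S: "(\<Sum>w\<in>S. g (?x w)) = 2 * g 1" for g :: "real \<Rightarrow> real"
    using card by (simp add: split_weight_def)
  have sum_T: "(\<Sum>w\<in>T. g (?x w)) = 2 * g \<alpha>" for g :: "real \<Rightarrow> real"
  proof -
    have "(\<Sum>w\<in>T. g (?x w)) = (\<Sum>w\<in>T. g \<alpha>)"
      using ST by (intro sum.cong) (auto simp: split_weight_def \<alpha>_def)
    then show ?thesis using card by simp
  qed
  have sum_R: "(\<Sum>w\<in>R. g (?x w)) = (real n - 4) * g \<gamma>" for g :: "real \<Rightarrow> real"
  proof -
    have "(\<Sum>w\<in>R. g (?x w)) = (\<Sum>w\<in>R. g \<gamma>)"
      by (intro sum.cong) (auto simp: split_weight_def R_def \<gamma>_def)
    then show ?thesis using cR by simp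
  qed
  consider "v \<in> S" | "v \<in> T" | "v \<in> R" using v V by blast
  then show ?thesis
  proof cases
    case 1
    then have xv: "?x v = 1" by (simp add: split_weight_def)
    have "{w. (v, w) \<in> split_arcs V S T} = V - {v}"
      using 1 ST by (auto simp: split_arcs_def)
    then have "(\<Sum>w | (v, w) \<in> split_arcs V S T. ?x v + ?x w) = (\<Sum>w\<in>V - {v}. 1 + ?x w)"
      by (simp only: xv)
    also have "\<dots> = (\<Sum>w\<in>V. 1 + ?x w) - 2"
      using v fin by (subst sum_diff1) (auto simp: xv)
    also have "(\<Sum>w\<in>V. 1 + ?x w) = 2 * (1 + 1) + (2 * (1 + \<alpha>) + (real n - 4) * (1 + \<gamma>))"
      unfolding V using disj finS
      by (simp only: sum.union_disjoint finite_UnI sum_S[of "\<lambda>y. 1 + y"] sum_T[of "\<lambda>y. 1 + y"]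
          sum_R[of "\<lambda>y. 1 + y"])
    also have "\<dots> - 2 = l * ?x v"
      unfolding xv using eq by (simp add: algebra_simps)
    finally show ?thesis .
  next
    case 2
    then have xv: "?x v = \<alpha>" using ST by (auto simp: split_weight_def \<alpha>_def)
    have "{w. (v, w) \<in> split_arcs V S T} = S"
      using 2 ST by (auto simp: split_arcs_def)
    then have "(\<Sum>w | (v, w) \<in> split_arcs V S T. ?x v + ?x w) = (\<Sum>w\<in>S. \<alpha> + ?x w)"
      by (simp only: xv)
    also have "\<dots> = 2 * (\<alpha> + 1)"
      by (rule sum_S[of "\<lambda>y. \<alpha> + y"])
    also have "\<dots> = l * ?x v"
      unfolding xv using \<alpha> by (simp add: algebra_simps)
    finally show ?thesis .
  next
    case 3
    then have xv: "?x v = \<gamma>" by (auto simp: split_weight_def R_def \<gamma>_def)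
    have "{w. (v, w) \<in> split_arcs V S T} = S \<union> R - {v}"
      using 3 ST by (auto simp: split_arcs_def R_def)
    then have "(\<Sum>w | (v, w) \<in> split_arcs V S T. ?x v + ?x w) = (\<Sum>w\<in>S \<union> R - {v}. \<gamma> + ?x w)"
      by (simp only: xv)
    also have "\<dots> = (\<Sum>w\<in>S \<union> R. \<gamma> + ?x w) - 2 * \<gamma>"
      using 3 finS by (subst sum_diff1) (auto simp: xv)
    also have "(\<Sum>w\<in>S \<union> R. \<gamma> + ?x w) = 2 * (\<gamma> + 1) + (real n - 4) * (\<gamma> + \<gamma>)"
      using disj finS
      by (simp only: sum.union_disjoint sum_S[of "\<lambda>y. \<gamma> + y"] sum_R[of "\<lambda>y. \<gamma> + y"])
    also have "\<dots> - 2 * \<gamma> = l * ?x v"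
      unfolding xv using \<gamma> by (simp add: algebra_simps)
    finally show ?thesis .
  qed
qed

section \<open>Recognising the extremal graph up to isomorphism\<close>

lemma split_arcs_image:
  assumes \<phi>: "inj_on \<phi> V" and ST: "S \<subseteq> V" "T \<subseteq> V"
  shows "map_prod \<phi> \<phi> ` split_arcs V S T = split_arcs (\<phi> ` V) (\<phi> ` S) (\<phi> ` T)"
proof -
  have mem: "\<phi> x \<in> \<phi> ` A \<longleftrightarrow> x \<in> A" if "x \<in> V" "A \<subseteq> V" for x A
    using inj_on_image_mem_iff[OF \<phi> that(1,2)] .
  have eq: "\<phi> x = \<phi> y \<longleftrightarrow> x = y" if "x \<in> V" "y \<in> V" for x y
    using inj_on_eq_iff[OF \<phi> that] .
  have iff: "(\<phi> x, \<phi> y) \<in> split_arcs (\<phi> ` V) (\<phi> ` S) (\<phi> ` T) \<longleftrightarrow> (x, y) \<in> split_arcs V S T"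
    if "x \<in> V" "y \<in> V" for x y
    using that ST by (simp add: split_arcs_def mem eq)
  show ?thesis
  proof (intro equalityI subsetI)
    fix p assume "p \<in> map_prod \<phi> \<phi> ` split_arcs V S T"
    then obtain x y where xy: "(x, y) \<in> split_arcs V S T" "p = (\<phi> x, \<phi> y)" by auto
    then have "x \<in> V" "y \<in> V" by (auto simp: split_arcs_def)
    with iff xy show "p \<in> split_arcs (\<phi> ` V) (\<phi> ` S) (\<phi> ` T)" by simp
  next
    fix p assume p: "p \<in> split_arcs (\<phi> ` V) (\<phi> ` S) (\<phi> ` T)"
    then obtain x y where xy: "x \<in> V" "y \<in> V" "p = (\<phi> x, \<phi> y)" by (auto simp: split_arcs_def)
    then have "(x, y) \<in> split_arcs V S T" using p iff by simp
    with xy show "p \<in> map_prod \<phi> \<phi> ` split_arcs V S T" by force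
  qed
qed

text \<open>\<open>split_arcs\<close> sees only equality and membership in \<open>S\<close> and
  \<open>T\<close>, so any bijection matching the three classes is an isomorphism; equal class sizes
  provide one.\<close>

lemma digraph_iso_split_arcs:
  fixes G :: "'a pair_pre_digraph" and H :: "'b pair_pre_digraph"
  assumes G: "finite (pverts G)" "S \<subseteq> pverts G" "T \<subseteq> pverts G" "S \<inter> T = {}"
      "parcs G = split_arcs (pverts G) S T"
    and H: "finite (pverts H)" "S' \<subseteq> pverts H" "T' \<subseteq> pverts H" "S' \<inter> T' = {}"
      "parcs H = split_arcs (pverts H) S' T'"
    and card: "card S = card S'" "card T = card T'" "card (pverts G) = card (pverts H)"
  shows "digraph_iso (with_proj G) (with_proj H)"
proof -
  let ?R = "pverts G - (S \<union> T)" and ?R' = "pverts H - (S' \<union> T')"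
  have fin: "finite S" "finite T" "finite S'" "finite T'"
    using G H by (auto intro: finite_subset)
  have "card ?R = card ?R'"
    using fin G H card by (simp add: card_Diff_subset card_Un_disjoint)
  then obtain h where h: "bij_betw h ?R ?R'"
    using G(1) H(1) by (metis finite_Diff finite_same_card_bij)
  obtain f where f: "bij_betw f S S'" using fin card by (metis finite_same_card_bij)
  obtain g where g: "bij_betw g T T'" using fin card by (metis finite_same_card_bij)
  define \<phi> where "\<phi> x = (if x \<in> S then f x else if x \<in> T then g x else h x)" for x
  have \<phi>S: "bij_betw \<phi> S S'" using f by (rule bij_betw_cong[THEN iffD1, rotated]) (simp add: \<phi>_def)
  have \<phi>T: "bij_betw \<phi> T T'"
    using g by (rule bij_betw_cong[THEN iffD1, rotated]) (use G(4) in \<open>auto simp: \<phi>_def\<close>)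
  have \<phi>R: "bij_betw \<phi> ?R ?R'" using h by (rule bij_betw_cong[THEN iffD1, rotated]) (simp add: \<phi>_def)
  have "bij_betw \<phi> (S \<union> T \<union> ?R) (S' \<union> T' \<union> ?R')"
    using \<phi>S \<phi>T \<phi>R H(4) by (intro bij_betw_combine) auto
  moreover have "S \<union> T \<union> ?R = pverts G" "S' \<union> T' \<union> ?R' = pverts H" using G H by auto
  ultimately have \<phi>: "bij_betw \<phi> (pverts G) (pverts H)" by simp
  then have inj: "inj_on \<phi> (pverts G)" and img: "\<phi> ` pverts G = pverts H"
    by (auto simp: bij_betw_def)
  have arcs: "parcs H = map_prod \<phi> \<phi> ` parcs G"
    using split_arcs_image[OF inj G(2,3)] \<phi>S \<phi>T G(5) H(5) img by (simp add: bij_betw_def)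
  have sub: "parcs G \<subseteq> pverts G \<times> pverts G" using G(5) by (auto simp: split_arcs_def)
  interpret pair_pre_digraph G .
  define hom where "hom = \<lparr> iso_verts = \<phi>, iso_arcs = map_prod \<phi> \<phi>, iso_head = snd, iso_tail = fst \<rparr>"
  have "wf_digraph (with_proj G)"
    using sub by unfold_locales auto
  moreover have "inj_on (map_prod \<phi> \<phi>) (parcs G)"
    using map_prod_inj_on[OF inj inj] sub by (rule inj_on_subset)
  ultimately have "digraph_isomorphism hom"
    using inj by (simp add: digraph_isomorphism_def hom_def)
  moreover have "with_proj H = app_iso hom (with_proj G)"
    by (simp add: app_iso_def hom_def with_proj_def img arcs)
  ultimately show ?thesis unfolding digraph_iso_def by blast
qed

lemma extremal_graph_split:
  assumes n: "n \<ge> 10"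
  shows "\<exists>S T. S \<subseteq> pverts (extremal_graph n) \<and> T \<subseteq> pverts (extremal_graph n) \<and> S \<inter> T = {} \<and>
    card S = 2 \<and> card T = 2 \<and> parcs (extremal_graph n) = split_arcs (pverts (extremal_graph n)) S T"
    and "finite (pverts (extremal_graph n))" and "card (pverts (extremal_graph n)) = n"
proof -
  let ?V = "pverts (extremal_graph n)"
  define S :: "(nat + (nat \<times> nat) + nat) set" where "S = Inl ` {..<2}"
  define T :: "(nat + (nat \<times> nat) + nat) set" where "T = Inr ` Inl ` ({..<2} \<times> {..<1})"
  have V: "?V = {..<2} <+> (({..<2} \<times> {..<1}) <+> {..<n - 4})"
    by (simp add: extremal_graph_def graph_join_def disjoint_union_def graph_copies_def complete_graph_def)
  show "finite ?V" "card ?V = n"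
    using n by (simp_all add: V card_Plus card_cartesian_product)
  have "card S = 2" "card T = 2"
    by (simp_all add: S_def T_def card_image card_cartesian_product)
  moreover have "S \<subseteq> ?V" "T \<subseteq> ?V" "S \<inter> T = {}"
    unfolding V by (auto simp: S_def T_def)
  moreover have "parcs (extremal_graph n) = split_arcs ?V S T"
    unfolding V split_arcs_def
    by (auto simp: S_def T_def extremal_graph_def graph_join_def disjoint_union_def graph_copies_def
        complete_graph_def)
  ultimately show "\<exists>S T. S \<subseteq> ?V \<and> T \<subseteq> ?V \<and> S \<inter> T = {} \<and> card S = 2 \<and> card T = 2 \<and>
      parcs (extremal_graph n) = split_arcs ?V S T"
    by blast
qed

lemma pair_graph_split_arcs:
  assumes fin: "finite (pverts G)" and arcs: "parcs G = split_arcs (pverts G) S T"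
  shows "pair_graph G"
proof -
  have sub: "parcs G \<subseteq> pverts G \<times> pverts G"
    unfolding arcs by (auto simp: split_arcs_def)
  have "(y, x) \<in> split_arcs V S T" if "(x, y) \<in> split_arcs V S T" for x y V
    using that by (auto simp: split_arcs_def)
  then have sym: "sym (parcs G)"
    unfolding arcs by (rule symI)
  have irrefl: "fst e \<noteq> snd e" if "e \<in> parcs G" for e
    using that unfolding arcs by (auto simp: split_arcs_def)
  show ?thesis
  proof
    show "finite (parcs G)" using sub fin by (blast intro: finite_subset)
    show "symmetric (with_proj G)" using sym by (simp add: symmetric_def)
  qed (use sub fin irrefl in auto)
qed

section \<open>Comparing the index with the dominant root\<close>

lemma split_weight_pos: "n \<ge> 10 \<Longrightarrow> l > 2 * real n - 6 \<Longrightarrow> split_weight n l S T w > 0"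
  by (simp add: split_weight_def)

lemma q_index_extremal_graph_ge:
  assumes n: "n \<ge> 10" and l: "l > 2 * real n - 6"
      "l = real n + 4 / (l - 2) + 2 * (real n - 4) / (l - 2 * real n + 8)"
  shows "l \<le> q_index (extremal_graph n)"
proof -
  let ?H = "extremal_graph n"
  obtain S T where ST: "S \<subseteq> pverts ?H" "T \<subseteq> pverts ?H" "S \<inter> T = {}" "card S = 2" "card T = 2"
    "parcs ?H = split_arcs (pverts ?H) S T"
    using extremal_graph_split(1)[OF n] by blast
  note V = extremal_graph_split(2,3)[OF n]
  interpret pair_graph ?H by (rule pair_graph_split_arcs[OF V(1) ST(6)])
  let ?x = "split_weight n l S T"
  show ?thesis
  proof (rule q_index_ge)
    show "\<exists>v\<in>pverts ?H. ?x v \<noteq> 0"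
      using split_weight_pos[OF n l(1), of S T] V(2) n by (metis card.empty ex_in_conv less_irrefl not_numeral_le_zero)
    fix v assume "v \<in> pverts ?H"
    then show "signless_laplacian ?H ?x v = l * ?x v"
      unfolding signless_laplacian_eq_sum ST(6)
      by (rule split_weight_row_sum[OF V(1) ST(1-5) V(2) n l])
  qed
qed

text \<open>If \<open>q \<ge> l\<close>, then equality holds throughout at a vertex maximising \<open>\<bar>z v\<bar> / x v\<close>, so none of its
  arcs is missing and all its neighbours are maximising as well; this spreads to all of \<open>G\<close>.\<close>

lemma (in pair_graph) q_index_less_of_split:
  assumes ST: "S \<subseteq> pverts G" "T \<subseteq> pverts G" "S \<inter> T = {}" "card S = 2" "card T = 2"
    and card: "card (pverts G) = n" and n: "n \<ge> 10" and l: "l > 2 * real n - 6"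
      "l = real n + 4 / (l - 2) + 2 * (real n - 4) / (l - 2 * real n + 8)"
    and sub: "parcs G \<subset> split_arcs (pverts G) S T"
  shows "q_index G < l"
proof (rule ccontr)
  assume "\<not> q_index G < l"
  then have ge: "l \<le> q_index G" by simp
  let ?x = "split_weight n l S T" and ?A = "split_arcs (pverts G) S T"
  have pos: "?x w > 0" for w by (rule split_weight_pos[OF n l(1)])
  have "pverts G \<noteq> {}" using card n by auto
  then obtain z where z: "\<exists>v\<in>pverts G. z v \<noteq> 0"
    "\<And>v. v \<in> pverts G \<Longrightarrow> signless_laplacian G z v = q_index G * z v"
    using q_index_eigenvector by blast
  have "\<exists>t>0. (\<exists>v\<in>pverts G. \<bar>z v\<bar> = t * ?x v) \<and> (\<forall>v\<in>pverts G. \<bar>z v\<bar> \<le> t * ?x v) \<and>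
    (\<forall>v\<in>pverts G. \<bar>z v\<bar> = t * ?x v \<longrightarrow>
      q_index G * (t * ?x v) \<le> (\<Sum>w | (v, w) \<in> parcs G. \<bar>z v\<bar> + \<bar>z w\<bar>))"
    by (rule eigenvector_maximum[OF z(1)]) (use z pos in auto)
  then obtain t where t: "t > 0" "\<exists>v\<in>pverts G. \<bar>z v\<bar> = t * ?x v"
    and le: "\<forall>v\<in>pverts G. \<bar>z v\<bar> \<le> t * ?x v"
    and max: "\<forall>v\<in>pverts G. \<bar>z v\<bar> = t * ?x v \<longrightarrow>
      q_index G * (t * ?x v) \<le> (\<Sum>w | (v, w) \<in> parcs G. \<bar>z v\<bar> + \<bar>z w\<bar>)"
    by (elim exE conjE)
  have propagate: "(v, w) \<in> parcs G \<and> \<bar>z w\<bar> = t * ?x w"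
    if v: "v \<in> pverts G" "\<bar>z v\<bar> = t * ?x v" and vw: "(v, w) \<in> ?A" for v w
  proof -
    \<comment> \<open>Counting absent arcs as 0 lets one sum over \<open>?A\<close> record both
      kinds of loss: a missing arc, and a neighbour with |z| below \<open>t * ?x\<close>.\<close>
    define h where "h w = (if (v, w) \<in> parcs G then \<bar>z v\<bar> + \<bar>z w\<bar> else 0)" for w
    define d where "d w = t * (?x v + ?x w) - h w" for w
    have fin: "finite {w. (v, w) \<in> ?A}"
      by (rule finite_subset[OF _ pair_finite_verts]) (auto simp: split_arcs_def)
    have d: "d w \<ge> 0" if "w \<in> {w. (v, w) \<in> ?A}" for w
      using that le v(2) t(1) pos[of v] pos[of w]
      by (auto simp: d_def h_def distrib_left split_arcs_def intro: add_nonneg_nonneg)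
    have "(\<Sum>w | (v, w) \<in> ?A. h w) = (\<Sum>w | (v, w) \<in> parcs G. \<bar>z v\<bar> + \<bar>z w\<bar>)"
      using sub fin by (intro sum.mono_neutral_cong_right) (auto simp: h_def)
    also have "\<dots> \<ge> q_index G * (t * ?x v)" using max v by blast
    finally have "(\<Sum>w | (v, w) \<in> ?A. h w) \<ge> q_index G * (t * ?x v)" .
    moreover have "q_index G * (t * ?x v) \<ge> l * (t * ?x v)"
      using ge t(1) pos[of v] by (intro mult_right_mono) auto
    moreover have "(\<Sum>w | (v, w) \<in> ?A. t * (?x v + ?x w)) = t * (l * ?x v)"
      unfolding sum_distrib_left[symmetric]
      by (simp only: split_weight_row_sum[OF pair_finite_verts ST(1-5) card n l v(1)])
    ultimately have "(\<Sum>w | (v, w) \<in> ?A. d w) \<le> 0"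
      by (simp add: d_def sum_subtractf algebra_simps)
    then have "(\<Sum>w | (v, w) \<in> ?A. d w) = 0"
      using sum_nonneg[of "{w. (v, w) \<in> ?A}" d] d by fastforce
    then have "d w = 0"
      using sum_nonneg_eq_0_iff[OF fin d] vw by simp
    moreover have "t * (?x v + ?x w) > 0" using t(1) pos[of v] pos[of w] by simp
    ultimately show ?thesis
      using v(2) by (auto simp: d_def h_def distrib_left split: if_splits)
  qed
  obtain v0 where v0: "v0 \<in> pverts G" "\<bar>z v0\<bar> = t * ?x v0" using t(2) by blast
  \<comment> \<open>In \<open>?A\<close> a vertex of \<open>S\<close> is joined to all others, so
    maximality passes from \<open>v0\<close> to \<open>s\<close> and from \<open>s\<close> to every
    vertex.\<close>
  obtain s where s: "s \<in> S" using ST(4) by (metis card.empty ex_in_conv zero_neq_numeral)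
  have sG: "s \<in> pverts G" using s ST(1) by blast
  have "(v0, s) \<in> ?A" if "s \<noteq> v0" using that s v0 sG ST(3) by (auto simp: split_arcs_def)
  then have zs: "\<bar>z s\<bar> = t * ?x s" using propagate[OF v0] v0(2) by (cases "s = v0") auto
  have "\<bar>z w\<bar> = t * ?x w" if "w \<in> pverts G" for w
  proof (cases "w = s")
    case False
    then have "(s, w) \<in> ?A" using that s sG ST(3) by (auto simp: split_arcs_def)
    then show ?thesis using propagate[OF sG zs] by blast
  qed (use zs in simp)
  then have "?A \<subseteq> parcs G" using propagate by (auto simp: split_arcs_def)
  with sub show False by blast
qed

section \<open>Violators of the Hall condition\<close>

context pair_graph begin

lemma ex_star_factor_with_arc:
  assumes uv: "(u, v) \<in> parcs G" and "k \<ge> 2"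
    and "\<And>X. X \<subseteq> pverts G - {u, v} \<Longrightarrow>
      card X \<le> 2 * card (parcs G `` X - {u, v}) + (if parcs G `` X \<inter> {u, v} = {} then 0 else 1)"
  shows "\<exists>H. star_factor k H G \<and>
    (\<exists>C\<in>components H. (u, v) \<in> arcs C \<and> (K\<^bsub>1,1\<^esub> C \<or> K\<^bsub>1,2\<^esub> C))"
proof -
  obtain F0 where F0: "F0 \<subseteq> parcs G" "sym F0" "(u, v) \<in> F0" "\<forall>x\<in>pverts G. F0 `` {x} \<noteq> {}"
    "\<forall>x\<in>pverts G. card (F0 `` {x}) \<le> 2" "F0 `` {u} = {v} \<or> F0 `` {v} = {u}"
    using ex_cover_with_arc[OF uv assms(3)] by blast
  have fin: "finite F0" using F0(1) pair_finite_arcs by (rule finite_subset)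
  have "\<exists>F\<subseteq>F0. sym F \<and> (u, v) \<in> F \<and> (\<forall>x\<in>pverts G. F `` {x} \<noteq> {}) \<and>
      (\<forall>(x, y)\<in>F. F `` {x} = {y} \<or> F `` {y} = {x})"
    using fin F0(2,3) _ F0(6) by (rule minimal_edge_cover) (use F0(4) in blast)
  then obtain F where F: "F \<subseteq> F0" "sym F" "(u, v) \<in> F" "\<forall>x\<in>pverts G. F `` {x} \<noteq> {}"
    "\<forall>(x, y)\<in>F. F `` {x} = {y} \<or> F `` {y} = {x}"
    by blast
  have deg: "card (F `` {x}) \<le> 2" if "x \<in> pverts G" for x
  proof -
    have "card (F `` {x}) \<le> card (F0 `` {x})"
      using F(1) fin by (intro card_mono finite_Image) auto
    then show ?thesis using F0(5) that by force
  qed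
  show ?thesis
    by (rule star_factor_of_cover[where F = F])
      (use F F0(1) deg \<open>k \<ge> 2\<close> pair_graph in auto)
qed

text \<open>Discarding from \<open>X\<close> its non-isolated vertices, all of which are neighbours of \<open>X\<close>, only
  increases the violation.\<close>

lemma independent_hall_violator:
  assumes X: "X \<subseteq> pverts G"
    and viol: "card X > 2 * card (parcs G `` X - D) + (if parcs G `` X \<inter> D = {} then 0 else 1)"
    and XD: "X \<inter> D = {}"
  shows "\<exists>Y\<subseteq>X. parcs G `` Y \<inter> Y = {} \<and>
    card Y > 2 * card (parcs G `` Y - D) + (if parcs G `` Y \<inter> D = {} then 0 else 1)"
proof -
  let ?N = "\<lambda>X. parcs G `` X"
  let ?Y = "X - ?N X"
  have fin: "finite X" "finite (?N Z)" for Z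
    using X by (auto intro: finite_subset[OF _ pair_finite_verts] dest: in_arcsD2)
  have NX: "?N ?Y \<inter> X = {}" using arcs_symmetric by blast
  \<comment> \<open>The discarded vertices lie in \<open>?N X - D\<close>, as \<open>X\<close>
    avoids \<open>D\<close>, but are not neighbours of \<open>?Y\<close>. Each one lowers the left
    side of the violation by 1 and the right side by 2.\<close>
  have "card (?N ?Y - D) + card (X \<inter> ?N X) = card ((?N ?Y - D) \<union> (X \<inter> ?N X))"
    using NX fin by (intro card_Un_disjoint[symmetric]) auto
  also have "\<dots> \<le> card (?N X - D)"
    using XD fin by (intro card_mono) auto
  finally have 1: "card (?N ?Y - D) + card (X \<inter> ?N X) \<le> card (?N X - D)" .
  have 2: "card X = card ?Y + card (X \<inter> ?N X)"
    using card_Int_Diff[OF fin(1), of "?N X"] by simp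
  have "?N ?Y \<inter> D \<subseteq> ?N X \<inter> D" by blast
  then have 3: "(if ?N ?Y \<inter> D = {} then 0 else 1) \<le> (if ?N X \<inter> D = {} then 0 else 1 :: nat)"
    by auto
  have "card ?Y > 2 * card (?N ?Y - D) + (if ?N ?Y \<inter> D = {} then 0 else 1)"
    using viol 1 2 3 by linarith
  then show ?thesis using NX by (intro exI[of _ ?Y]) auto
qed

text \<open>The numerical hypotheses are the row inequalities outside \<open>S \<union> T\<close>, in \<open>T\<close> and in \<open>S\<close>. The
  summand \<open>4 / n\<close> is needed only for \<open>n = 10\<close>, \<open>s = 3, 4\<close>, where the bound \<open>2n - 6\<close> fails for this
  vector.\<close>

lemma q_index_le_of_independent:
  fixes s t r n :: nat
  assumes S: "S \<subseteq> pverts G" and T: "T \<subseteq> pverts G" and ST: "S \<inter> T = {}"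
    and NT: "parcs G `` T \<subseteq> S"
    and card: "card S = s" "card T = t" "card (pverts G) = n" "n = s + t + r" "n > 0"
    and sR: "s + 4 \<le> 2 * t" and sT: "3 * s + 12 \<le> 4 * (t + r)"
    and sS: "6 * real t + 5 * real r + 40 / real n \<ge> 40"
  shows "q_index G \<le> 2 * real n - 6 + 4 / real n"
proof -
  let ?V = "pverts G" and ?c = "2 * real n - 6 + 4 / real n"
  \<comment> \<open>Smaller weights off \<open>S\<close> relax the rows of \<open>S\<close> but
    tighten those of \<open>T\<close> and \<open>R\<close>. With 2/5 and 1/2, clearing denominators
    turns the three row conditions into \<open>sT\<close>, \<open>sR\<close> and \<open>sS\<close>;
    only the row of \<open>S\<close> uses the summand 4/n.\<close>
  define x where "x w = (if w \<in> S then 1 else if w \<in> T then 2 / 5 else 1 / 2 :: real)" for w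
  define R where "R = ?V - S - T"
  have fin: "finite S" "finite T" "finite R"
    using S T by (auto simp: R_def intro: finite_subset[OF _ pair_finite_verts])
  have V: "?V = S \<union> (T \<union> R)" using S T by (auto simp: R_def)
  have disj: "S \<inter> (T \<union> R) = {}" "T \<inter> R = {}" "S \<inter> R = {}" using ST by (auto simp: R_def)
  have cR: "card R = r"
    using card card_Un_disjoint[of S "T \<union> R"] card_Un_disjoint[of T R] fin disj V by simp
  have sum_S: "(\<Sum>w\<in>S. g (x w)) = s * g 1" for g :: "real \<Rightarrow> real"
    using card by (simp add: x_def)
  have sum_T: "(\<Sum>w\<in>T. g (x w)) = t * g (2 / 5)" for g :: "real \<Rightarrow> real"
  proof -
    have "(\<Sum>w\<in>T. g (x w)) = (\<Sum>w\<in>T. g (2 / 5))"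
      using ST by (intro sum.cong) (auto simp: x_def)
    then show ?thesis using card by simp
  qed
  have sum_R: "(\<Sum>w\<in>R. g (x w)) = r * g (1 / 2)" for g :: "real \<Rightarrow> real"
  proof -
    have "(\<Sum>w\<in>R. g (x w)) = (\<Sum>w\<in>R. g (1 / 2))"
      by (intro sum.cong) (auto simp: x_def R_def)
    then show ?thesis using cR by simp
  qed
  have pos: "x w > 0" for w by (simp add: x_def)
  have row: "signless_laplacian G x v \<le> (\<Sum>w\<in>A. x v + x w)"
    if "finite A" "{w. (v, w) \<in> parcs G} \<subseteq> A" for v A
    unfolding signless_laplacian_eq_sum using that pos
    by (intro sum_mono2) (auto intro: less_imp_le add_pos_pos)
  have n_real: "real n = real s + real t + real r" using card(4) by simp
  have n4: "4 / real n \<ge> 0" by simp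
  show ?thesis
  proof (rule q_index_le)
    show "?V \<noteq> {}" using card by auto
    show "x v > 0" for v by (rule pos)
    fix v assume v: "v \<in> ?V"
    consider "v \<in> S" | "v \<in> T" | "v \<in> R" using v V by blast
    then show "signless_laplacian G x v \<le> ?c * x v"
    proof cases
      case 1
      then have xv: "x v = 1" by (simp add: x_def)
      have "signless_laplacian G x v \<le> (\<Sum>w\<in>?V - {v}. x v + x w)"
        using no_loops' by (intro row) (auto dest: in_arcsD2)
      also have "\<dots> = (\<Sum>w\<in>?V. 1 + x w) - 2"
        using v by (subst sum_diff1) (auto simp: xv)
      also have "(\<Sum>w\<in>?V. 1 + x w) = s * 2 + (t * (7 / 5) + r * (3 / 2))"
        unfolding V using disj fin
        by (simp only: sum.union_disjoint finite_UnI sum_S[of "\<lambda>y. 1 + y"] sum_T[of "\<lambda>y. 1 + y"]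
            sum_R[of "\<lambda>y. 1 + y"]) simp
      finally show ?thesis using sS n_real by (simp add: xv)
    next
      case 2
      then have xv: "x v = 2 / 5" using ST by (auto simp: x_def)
      have "signless_laplacian G x v \<le> (\<Sum>w\<in>S. x v + x w)"
        using NT 2 fin by (intro row) auto
      also have "\<dots> = s * (7 / 5)" using sum_S[of "\<lambda>y. x v + y"] by (simp add: xv)
      also have "\<dots> \<le> (2 * real n - 6) * (2 / 5)" using sT n_real by simp
      also have "\<dots> \<le> ?c * x v" unfolding xv using n4 by (intro mult_right_mono) auto
      finally show ?thesis .
    next
      case 3
      then have xv: "x v = 1 / 2" by (auto simp: x_def R_def)
      have "w \<notin> T" if "(v, w) \<in> parcs G" for w
        using arcs_symmetric[OF that] NT 3 by (auto simp: R_def)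
      then have "{w. (v, w) \<in> parcs G} \<subseteq> S \<union> R - {v}"
        using no_loops' by (auto simp: R_def dest: in_arcsD2)
      then have "signless_laplacian G x v \<le> (\<Sum>w\<in>S \<union> R - {v}. x v + x w)"
        using fin by (intro row) auto
      also have "\<dots> = (\<Sum>w\<in>S \<union> R. x v + x w) - 1"
        using 3 fin by (subst sum_diff1) (auto simp: xv)
      also have "(\<Sum>w\<in>S \<union> R. x v + x w) = s * (3 / 2) + r"
        using disj fin unfolding xv
        by (simp only: sum.union_disjoint sum_S[of "\<lambda>y. 1 / 2 + y"] sum_R[of "\<lambda>y. 1 / 2 + y"]) simp
      also have "s * (3 / 2) + r - 1 \<le> (2 * real n - 6) * (1 / 2)"
        using sR n_real by simp
      also have "\<dots> \<le> ?c * x v" unfolding xv using n4 by (intro mult_right_mono) auto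
      finally show ?thesis .
    qed
  qed
qed

end

section \<open>Case analysis of an independent violator\<close>

lemma (in pair_graph) extremal_graph_or_star_factor:
  assumes k: "k \<ge> 2" and card: "card (pverts G) = n" and n: "n \<ge> 10"
    and no_isolated: "\<And>v. v \<in> pverts G \<Longrightarrow> parcs G `` {v} \<noteq> {}"
    and q: "q_index G \<ge> q_index (extremal_graph n)"
    and uv: "(u, v) \<in> parcs G"
    and no_factor: "\<not> (\<exists>H. star_factor k H G \<and>
      (\<exists>C\<in>components H. (u, v) \<in> arcs C \<and> (K\<^bsub>1,1\<^esub> C \<or> K\<^bsub>1,2\<^esub> C)))"
  shows "digraph_iso (with_proj G) (with_proj (extremal_graph n))"
proof -
  let ?V = "pverts G" and ?N = "\<lambda>X. parcs G `` X"
  obtain l where l: "l > 2 * real n - 6 + 4 / real n"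
      "l = real n + 4 / (l - 2) + 2 * (real n - 4) / (l - 2 * real n + 8)"
    using ex_dominant_root[OF n] by blast
  have "4 / real n \<ge> 0" by simp
  then have l': "l > 2 * real n - 6" using l(1) by linarith
  have ql: "q_index G \<ge> l" using q q_index_extremal_graph_ge[OF n l' l(2)] by linarith
  have uvV: "u \<in> ?V" "v \<in> ?V" "u \<noteq> v" using uv in_arcsD1 in_arcsD2 no_loops' by blast+
  have "\<exists>X\<subseteq>?V - {u, v}.
      \<not> card X \<le> 2 * card (?N X - {u, v}) + (if ?N X \<inter> {u, v} = {} then 0 else 1)"
  proof (rule ccontr)
    assume "\<not> ?thesis"
    then have "card X \<le> 2 * card (?N X - {u, v}) + (if ?N X \<inter> {u, v} = {} then 0 else 1)"
      if "X \<subseteq> ?V - {u, v}" for X using that by blast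
    from ex_star_factor_with_arc[OF uv k this] no_factor show False by blast
  qed
  then obtain X where X: "X \<subseteq> ?V - {u, v}"
    "\<not> card X \<le> 2 * card (?N X - {u, v}) + (if ?N X \<inter> {u, v} = {} then 0 else 1)"
    by blast
  have "\<exists>Y\<subseteq>X. ?N Y \<inter> Y = {} \<and>
      card Y > 2 * card (?N Y - {u, v}) + (if ?N Y \<inter> {u, v} = {} then 0 else 1)"
    by (rule independent_hall_violator) (use X in auto)
  then obtain Y where YX: "Y \<subseteq> X" and NY: "?N Y \<inter> Y = {}"
    and viol: "card Y > 2 * card (?N Y - {u, v}) + (if ?N Y \<inter> {u, v} = {} then 0 else 1)"
    by blast
  define P where "P = ?N Y - {u, v}"
  have YV: "Y \<subseteq> ?V" "u \<notin> Y" "v \<notin> Y" using YX X by auto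
  have PV: "P \<subseteq> ?V" by (auto simp: P_def dest: in_arcsD2)
  have fin: "finite Y" "finite P" using YV PV by (auto intro: finite_subset[OF _ pair_finite_verts])
  have PY: "P \<inter> Y = {}" using NY by (auto simp: P_def)
  have S_disj: "(P \<union> {u, v}) \<inter> Y = {}" using PY YV by auto
  have cS: "card (P \<union> {u, v}) = card P + 2"
    using fin uvV by (subst card_Un_disjoint) (auto simp: P_def)
  have "card (P \<union> {u, v} \<union> Y) = card P + 2 + card Y"
    using fin S_disj cS by (subst card_Un_disjoint) auto
  moreover have "card (P \<union> {u, v} \<union> Y) \<le> card ?V"
    using PV YV uvV by (intro card_mono) auto
  ultimately have le_n: "card P + 2 + card Y \<le> n" using card by simp
  show ?thesis
  proof (cases "?N Y \<inter> {u, v} = {}")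
    case True
    \<comment> \<open>Here \<open>P\<close> alone separates \<open>Y\<close>. The vertices
      \<open>u\<close> and \<open>v\<close> belong to neither set, which gives
      \<open>r \<ge> 2\<close>.\<close>
    define r where "r = n - (card P + card Y)"
    have nr: "n = card P + card Y + r" "r \<ge> 2" using le_n by (simp_all add: r_def)
    have t: "card Y \<ge> 2 * card P + 1" using viol unfolding P_def if_P[OF True] by linarith
    then obtain y where "y \<in> Y" by fastforce
    \<comment> \<open>Isolated vertices would violate Hall's condition with no neighbours at all;
      excluding them forces \<open>P\<close> to be nonempty.\<close>
    then have "?N Y \<noteq> {}" using no_isolated[of y] YV by blast
    then have "P \<noteq> {}" using True by (auto simp: P_def)
    then have p: "card P \<ge> 1" using fin by (simp add: Suc_le_eq card_gt_0_iff)
    have "6 * card Y + 5 * r \<ge> 40"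
      using t p nr n by linarith
    then have "6 * real (card Y) + 5 * real r \<ge> 40" by linarith
    then have sS: "6 * real (card Y) + 5 * real r + 40 / real n \<ge> 40" by (simp add: add_increasing2)
    have "q_index G \<le> 2 * real n - 6 + 4 / real n"
      by (rule q_index_le_of_independent[of P Y _ _ n r])
        (use PV YV PY True nr card n t p sS in \<open>auto simp: P_def\<close>)
    with ql l(1) show ?thesis by linarith
  next
    case False
    have t: "card Y \<ge> 2 * card P + 2" using viol unfolding P_def if_not_P[OF False] by linarith
    show ?thesis
    proof (cases "P = {}")
      case False
      define r where "r = n - (card P + 2 + card Y)"
      have nr: "n = (card P + 2) + card Y + r" using le_n by (simp add: r_def)
      have p: "card P \<ge> 1" using False fin by (simp add: Suc_le_eq card_gt_0_iff)
      \<comment> \<open>For n = 10 the least value of the first two summands is 36, at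
        \<open>card P = 2\<close>, \<open>card Y = 6\<close>, \<open>r = 0\<close>; there 40/n = 4
        makes up exactly the difference.\<close>
      have "6 * real (card Y) + 5 * real r + 40 / real n \<ge> 40"
      proof (cases "n = 10")
        case True
        have "6 * card Y + 5 * r \<ge> 36" using t p nr True by linarith
        then have "6 * real (card Y) + 5 * real r \<ge> 36" by linarith
        then show ?thesis using True by simp
      next
        case False
        then have "6 * card Y + 5 * r \<ge> 40" using t p nr n by linarith
        then have "6 * real (card Y) + 5 * real r \<ge> 40" by linarith
        then show ?thesis by (simp add: add_increasing2)
      qed
      moreover have "3 * (card P + 2) + 12 \<le> 4 * (card Y + r)"
      proof -
        have "3 * card P + 18 \<le> 4 * card Y + 4 * r"
          using t p nr n by (cases "card P = 1"; linarith)
        then show ?thesis by simp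
      qed
      moreover have "card P + 2 + 4 \<le> 2 * card Y" using t p by linarith
      moreover have "?N Y \<subseteq> P \<union> {u, v}" by (auto simp: P_def)
      ultimately have "q_index G \<le> 2 * real n - 6 + 4 / real n"
        using PV YV uvV S_disj cS nr card n
        by (intro q_index_le_of_independent[of "P \<union> {u, v}" Y "card P + 2" "card Y" n r]) auto
      with ql l(1) show ?thesis by linarith
    next
      case True
      \<comment> \<open>\<open>Y\<close> may be larger than 2. Any two of its vertices make
        \<open>G\<close> a spanning subgraph of a split graph, and the strict bound then excludes a
        missing arc.\<close>
      obtain T where T: "T \<subseteq> Y" "card T = 2"
        using t obtain_subset_with_card_n[of 2 Y] by auto
      have S: "{u, v} \<subseteq> ?V" "card {u, v} = 2" "{u, v} \<inter> T = {}" "T \<subseteq> ?V"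
        using uvV YV T by auto
      have NT: "y \<in> {u, v}" if "(x, y) \<in> parcs G" "x \<in> T" for x y
        using that T True by (auto simp: P_def)
      have "(x, y) \<in> split_arcs ?V {u, v} T" if xy: "(x, y) \<in> parcs G" for x y
        using xy arcs_symmetric[OF xy] in_arcsD1[OF xy] in_arcsD2[OF xy] no_loops'[OF xy]
          NT[of x y] NT[of y x]
        by (simp add: split_arcs_def)
      then have sub: "parcs G \<subseteq> split_arcs ?V {u, v} T" by auto
      have arcs: "parcs G = split_arcs ?V {u, v} T"
      proof (rule ccontr)
        assume "\<not> ?thesis"
        then have "q_index G < l"
          using sub by (intro q_index_less_of_split[OF S(1,4,3,2) T(2) card n l' l(2)]) auto
        with ql show False by simp
      qed
      obtain S' T' where ST': "S' \<subseteq> pverts (extremal_graph n)" "T' \<subseteq> pverts (extremal_graph n)"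
        "S' \<inter> T' = {}" "card S' = 2" "card T' = 2"
        "parcs (extremal_graph n) = split_arcs (pverts (extremal_graph n)) S' T'"
        using extremal_graph_split(1)[OF n] by blast
      show ?thesis
        by (rule digraph_iso_split_arcs[of G "{u, v}" T _ S' T'])
          (use S T(2) arcs ST' card extremal_graph_split(2,3)[OF n] pair_finite_verts in simp_all)
    qed
  qed
qed

theorem theorem1p4:
  fixes G :: "'a pair_pre_digraph" and k n :: nat
  assumes "k \<ge> 2"
    and "pair_graph G"
    and "card (pverts G) = n"
    and "n \<ge> 2 * k + 6"
    and "\<forall>v \<in> pverts G. out_degree (with_proj G) v \<noteq> 0"
    and "q_index G \<ge> q_index (extremal_graph n)"
    and "\<not> digraph_iso (with_proj G) (with_proj (extremal_graph n))"
  shows "\<forall>e \<in> parcs G. \<exists>F. star_factor k F G \<and>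
    (\<exists>C \<in> components F. e \<in> arcs C \<and> (K\<^bsub>1,1\<^esub> C \<or> K\<^bsub>1,2\<^esub> C))"
proof
  fix e assume e: "e \<in> parcs G"
  interpret pair_graph G by fact
  obtain u v where uv: "e = (u, v)" by (cases e)
  have "parcs G `` {w} \<noteq> {}" if "w \<in> pverts G" for w
    using assms(5) that by (auto simp: out_degree_eq_card)
  \<comment> \<open>\<open>k \<ge> 2\<close> turns \<open>n \<ge> 2 * k + 6\<close> into the order
    at least 10 on which the spectral estimates rest.\<close>
  then show "\<exists>F. star_factor k F G \<and>
      (\<exists>C\<in>components F. e \<in> arcs C \<and> (K\<^bsub>1,1\<^esub> C \<or> K\<^bsub>1,2\<^esub> C))"
    using extremal_graph_or_star_factor[OF \<open>k \<ge> 2\<close> assms(3) _ _ assms(6), of u v] assms(1,4,7) e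
    unfolding uv by fastforce
qed

end
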